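(* For all positive integers $m$ and $p$, $$(-1)^m \sum_{j=1}^p W(2j+2m-1,2m)\,Z(j,p)=(-1)^p \sum_{j=1}^m W(2j+2p-1,2p)\,Z(j,m).$$
   Context: For positive integers $k_1,\dots,k_r$ the alternating multiple $T$-value is $\bar T(k_1,\ldots,k_r):=2^r\sum_{0<n_1<\cdots<n_r}\frac{(-1)^{n_r}}{(2n_1-1)^{k_1}(2n_2-2)^{k_2}\cdots(2n_r-r)^{k_r}}$ (conditionally convergent series), with $\bar T(\emptyset):=1$. $I(k,r)$ denotes the set of tuples $(k_1,\dots,k_r)$ of positive integers with $k_1+\cdots+k_r=k$. For a positive integer $m$, $W_m(k,r):=\sum_{(k_1,\dots,k_r)\in I(k,r)}\binom{k_r+m-2}{m-1}\bar T(k_1,\ldots,k_{r-1},k_r+m-1)$, and $W(k,r):=W_1(k,r)=\sum_{(k_1,\dots,k_r)\in I(k,r)}\bar T(k_1,\dots,k_r)$. $\bar\zeta(s):=\sum_{n\ge1}(-1)^{n-1}n^{-s}$ for integers $s\ge1$, and $\bar\zeta(0):=1/2$. For integers $1\le j\le p$: $Z(p,p):=1$ and, for $j<p$, $Z(j,p):=\sum_{k=1}^{p-j}(-2)^k\sum_{j=i_0<i_1<\cdots<i_{k-1}<i_k=p}\ \prod_{l=1}^k\bar\zeta(2i_l-2i_{l-1})$ (inner sum over integers $i_1<\dots<i_{k-1}$ strictly between $j$ and $p$). *)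

theory Defs
  imports Complex_Main
begin

definition Tbar_partial :: "nat list \<Rightarrow> nat \<Rightarrow> real" where
  "Tbar_partial ks N =
     (\<Sum>ns \<in> {ns. length ns = length ks \<and> sorted_wrt (<) ns \<and> set ns \<subseteq> {1..N}}.
        (-1) ^ (last ns) /
        (\<Prod>i<length ks. (2 * real (ns ! i) - real (i + 1)) ^ (ks ! i)))"

text \<open>Alternating multiple T-value; the series is summed in order of n_r
  (limit of the partial sums over n_r \<le> N).\<close>
definition Tbar :: "nat list \<Rightarrow> real" where
  "Tbar ks = (if ks = [] then 1
              else 2 ^ length ks * lim (\<lambda>N. Tbar_partial ks N))"

definition Icomp :: "nat \<Rightarrow> nat \<Rightarrow> nat list set" where
  "Icomp k r = {ks. length ks = r \<and> (\<forall>x\<in>set ks. 0 < x) \<and> sum_list ks = k}"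

definition W :: "nat \<Rightarrow> nat \<Rightarrow> real" where
  "W k r = (\<Sum>ks \<in> Icomp k r. Tbar ks)"

definition zetabar :: "nat \<Rightarrow> real" where
  "zetabar s = (if s = 0 then 1/2 else (\<Sum>n. (-1) ^ n / (real (n + 1)) ^ s))"

definition Zc :: "nat \<Rightarrow> nat \<Rightarrow> real" where
  "Zc j p = (if j = p then 1 else
     (\<Sum>k=1..p-j. (-2) ^ k *
        (\<Sum>is \<in> {is. length is = k + 1 \<and> sorted_wrt (<) is \<and> set is \<subseteq> {j..p}
                      \<and> is ! 0 = j \<and> is ! k = p}.
           (\<Prod>l=1..k. zetabar (2 * (is ! l) - 2 * (is ! (l - 1)))))))"

end

theory Submission
  imports Defs "HOL-Probability.Probability" "HOL-Real_Asymp.Real_Asymp"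
begin

text \<open>
  Summing over all compositions turns the iterated integral of the alternating T-values into the
  single integral of \<open>v^(2j-1)/(2j-1)! * g(v)^(2m-1)/(2m-1)! / cosh v\<close> over \<open>v > 0\<close>, which equals
  \<open>W(2j+2m-1, 2m)\<close>; here \<open>g(v) = pi/2 - 2 arctan (exp (-v))\<close> is the Gudermannian. The matrix \<open>Z\<close> is
  inverse to the upper triangular matrix with entries \<open>2 * zetabar (2i - 2j)\<close>, so the claim becomes
  the symmetry in \<open>m\<close> and \<open>j\<close> of the sum over \<open>i\<close> of
  \<open>2 * zetabar (2m - 2i) * (-1)^i * W(2j+2i-1, 2i)\<close>. The polynomial
  \<open>2 * zetabar (2m - 2i) * (-1)^(i-1) * x^(2i-1)/(2i-1)!\<close>, summed over \<open>i\<close>, is the integral over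
  \<open>w > 0\<close> of \<open>w^(2m-2)/(2m-2)! * sin x / (cosh w + cos x)\<close>. Substituting \<open>x = g(v)\<close>, where
  \<open>sin x = tanh v\<close> and \<open>cos x = 1 / cosh v\<close>, and integrating by parts in \<open>w\<close>, the sum becomes, up to sign,
  the double integral of
  \<open>v^(2j-1)/(2j-1)! * w^(2m-1)/(2m-1)! * sinh v * sinh w / (1 + cosh v * cosh w)^2\<close>,
  which is visibly symmetric.
\<close>

section \<open>The inverse of the matrix Z\<close>

definition zeta_chains :: "nat \<Rightarrow> nat \<Rightarrow> nat \<Rightarrow> nat list set" where
  "zeta_chains j p k = {is. length is = k + 1 \<and> sorted_wrt (<) is \<and> set is \<subseteq> {j..p}
                      \<and> is ! 0 = j \<and> is ! k = p}"

definition zeta_chain_sum :: "nat \<Rightarrow> nat \<Rightarrow> nat \<Rightarrow> real" where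
  "zeta_chain_sum j p k = (-2) ^ k *
     (\<Sum>is \<in> zeta_chains j p k. \<Prod>l=1..k. zetabar (2 * (is ! l) - 2 * (is ! (l - 1))))"

lemma finite_zeta_chains: "finite (zeta_chains j p k)"
  unfolding zeta_chains_def
  by (rule finite_subset[OF _ finite_lists_length_eq[of "{j..p}" "k+1"]]) auto

lemma zeta_chains_empty:
  assumes "p - j < k"
  shows "zeta_chains j p k = {}"
proof -
  have False if "is \<in> zeta_chains j p k" for "is"
  proof -
    have "distinct is"
      using that by (auto simp: zeta_chains_def strict_sorted_iff)
    then have "k + 1 = card (set is)"
      using that by (simp add: distinct_card zeta_chains_def)
    also have "\<dots> \<le> card {j..p}"
      using that by (intro card_mono) (auto simp: zeta_chains_def)
    finally have "k + 1 \<le> p + 1 - j" by simp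
    moreover have "j \<in> set is"
      using that nth_mem[of 0 "is"] by (auto simp: zeta_chains_def)
    then have "j \<le> p" using that by (auto simp: zeta_chains_def)
    ultimately show False using assms by simp
  qed
  then show ?thesis by blast
qed

lemma zeta_chains_0: "zeta_chains j p 0 = (if j = p then {[p]} else {})"
  by (auto simp: zeta_chains_def length_Suc_conv)

lemma zeta_chains_Suc:
  "zeta_chains j p (Suc k) = (\<Union>i\<in>{Suc j..p}. (#) j ` zeta_chains i p k)" (is "?L = ?R")
proof (intro equalityI subsetI)
  fix xs assume xs: "xs \<in> ?L"
  then obtain ys where ys: "xs = j # ys" "length ys = Suc k"
    by (cases xs) (auto simp: zeta_chains_def)
  then obtain i zs where zs: "ys = i # zs" by (cases ys) auto
  have "ys \<in> zeta_chains i p k" "i \<in> {Suc j..p}"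
    using xs ys zs by (auto simp: zeta_chains_def less_imp_le)
  then show "xs \<in> ?R" using ys by blast
next
  fix xs assume "xs \<in> ?R"
  then obtain i ys where i: "i \<in> {Suc j..p}" and ys: "ys \<in> zeta_chains i p k" and xs: "xs = j # ys"
    by blast
  have "ys \<noteq> []" using ys by (auto simp: zeta_chains_def)
  then show "xs \<in> ?L"
    using i ys xs by (fastforce simp: zeta_chains_def)
qed

text \<open>A chain is split at its first step, from \<open>j\<close> to \<open>i\<close>: that step
  carries the factor \<open>-2 * zetabar (2*i - 2*j)\<close>, and the tail is a chain starting at
  \<open>i\<close>.\<close>

lemma zeta_chain_sum_Suc:
  "zeta_chain_sum j p (Suc k) = (\<Sum>i=Suc j..p. -2 * zetabar (2*i - 2*j) * zeta_chain_sum i p k)"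
proof -
  let ?w = "\<lambda>k is. \<Prod>l=1..k. zetabar (2 * (is ! l) - 2 * (is ! (l - 1)))"
  have w: "?w (Suc k) (j # xs) = zetabar (2*i - 2*j) * ?w k xs" if "xs \<in> zeta_chains i p k" for i xs
  proof -
    have "?w (Suc k) (j # xs) = (\<Prod>l\<in>{0..k}. zetabar (2 * ((j#xs) ! Suc l) - 2 * ((j#xs) ! l)))"
      using prod.shift_bounds_cl_Suc_ivl[of "\<lambda>l. zetabar (2 * ((j#xs) ! l) - 2 * ((j#xs) ! (l - 1)))" 0 k]
      by simp
    also have "\<dots> = zetabar (2*i - 2*j) * (\<Prod>l\<in>{Suc 0..k}. zetabar (2 * ((j#xs) ! Suc l) - 2 * ((j#xs) ! l)))"
      using that by (subst prod.atLeast_Suc_atMost) (auto simp: zeta_chains_def)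
    also have "(\<Prod>l\<in>{Suc 0..k}. zetabar (2 * ((j#xs) ! Suc l) - 2 * ((j#xs) ! l))) = ?w k xs"
      by (intro prod.cong) (auto simp: nth_Cons')
    finally show ?thesis .
  qed
  have disj: "\<forall>i\<in>{Suc j..p}. \<forall>i'\<in>{Suc j..p}. i \<noteq> i' \<longrightarrow>
      (#) j ` zeta_chains i p k \<inter> (#) j ` zeta_chains i' p k = {}"
    by (auto simp: zeta_chains_def)
  have "(\<Sum>is \<in> zeta_chains j p (Suc k). ?w (Suc k) is)
      = (\<Sum>i=Suc j..p. \<Sum>is\<in>(#) j ` zeta_chains i p k. ?w (Suc k) is)"
    unfolding zeta_chains_Suc
    by (rule sum.UNION_disjoint) (use disj in \<open>auto intro: finite_zeta_chains\<close>)
  also have "\<dots> = (\<Sum>i=Suc j..p. zetabar (2*i - 2*j) * (\<Sum>is\<in>zeta_chains i p k. ?w k is))"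
    using w by (intro sum.cong refl) (simp add: sum.reindex sum_distrib_left)
  finally show ?thesis
    unfolding zeta_chain_sum_def by (simp add: sum_distrib_left mult_ac)
qed

text \<open>No chain has more than \<open>p - j\<close> steps, so any larger cutoff \<open>K\<close>
  may be used. A cutoff common to all starting points is what allows the sums over \<open>i\<close>
  and \<open>k\<close> to be swapped in \<open>Zc_rec\<close>.\<close>

lemma Zc_eq_zeta_chain_sum:
  assumes "j \<le> p" "p - j \<le> K"
  shows "Zc j p = (\<Sum>k\<le>K. zeta_chain_sum j p k)"
proof (cases "j = p")
  case True
  have "(\<Sum>k\<le>K. zeta_chain_sum j p k) = (\<Sum>k\<in>{0}. zeta_chain_sum j p k)"
    using True by (intro sum.mono_neutral_right) (auto simp: zeta_chain_sum_def zeta_chains_empty)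
  then show ?thesis using True by (simp add: Zc_def zeta_chain_sum_def zeta_chains_0)
next
  case False
  have "(\<Sum>k\<le>K. zeta_chain_sum j p k) = (\<Sum>k=1..p-j. zeta_chain_sum j p k)"
  proof (intro sum.mono_neutral_right ballI)
    fix k assume "k \<in> {..K} - {1..p-j}"
    then have "k = 0 \<or> p - j < k" by auto
    then show "zeta_chain_sum j p k = 0"
      using False by (auto simp: zeta_chain_sum_def zeta_chains_empty zeta_chains_0)
  qed (use assms in auto)
  then show ?thesis using False by (simp add: Zc_def zeta_chain_sum_def zeta_chains_def)
qed

lemma Zc_rec:
  assumes "j < p"
  shows "Zc j p = (\<Sum>i=Suc j..p. -2 * zetabar (2*i - 2*j) * Zc i p)"
proof -
  have "Zc j p = (\<Sum>k\<le>Suc p. zeta_chain_sum j p k)"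
    using assms by (intro Zc_eq_zeta_chain_sum) auto
  also have "\<dots> = (\<Sum>k\<le>p. zeta_chain_sum j p (Suc k))"
    using assms by (subst sum.atMost_Suc_shift) (simp add: zeta_chain_sum_def zeta_chains_0)
  also have "\<dots> = (\<Sum>i=Suc j..p. -2 * zetabar (2*i - 2*j) * (\<Sum>k\<le>p. zeta_chain_sum i p k))"
    unfolding zeta_chain_sum_Suc sum_distrib_left by (rule sum.swap)
  also have "\<dots> = (\<Sum>i=Suc j..p. -2 * zetabar (2*i - 2*j) * Zc i p)"
    by (intro sum.cong refl, subst Zc_eq_zeta_chain_sum[where K=p]) auto
  finally show ?thesis .
qed

text \<open>Because \<open>zetabar 0 = 1/2\<close>, the term \<open>i = j\<close> has coefficient 1,
  and \<open>Zc_rec\<close> says that the remaining terms cancel it.\<close>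

lemma Zc_inverse:
  assumes "j \<le> p"
  shows "(\<Sum>i=j..p. 2 * zetabar (2*i - 2*j) * Zc i p) = (if j = p then 1 else 0)"
proof (cases "j = p")
  case True
  then show ?thesis by (simp add: zetabar_def Zc_def)
next
  case False
  have "(\<Sum>i=j..p. 2 * zetabar (2*i - 2*j) * Zc i p)
      = Zc j p + (\<Sum>i=Suc j..p. 2 * zetabar (2*i - 2*j) * Zc i p)"
    using assms by (subst sum.atLeast_Suc_atMost) (auto simp: zetabar_def)
  also have "\<dots> = 0"
    using False assms by (subst Zc_rec) (auto simp flip: sum.distrib)
  finally show ?thesis using False by simp
qed

text \<open>With \<open>B i j = 2 * zetabar (2*j - 2*i)\<close> the matrix \<open>C = B\<^sup>T M\<close> is symmetric and
  \<open>B Z = 1\<close>, so \<open>M Z = Z\<^sup>T C Z\<close> is symmetric as well.\<close>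
lemma Zc_transform_symmetric:
  fixes M :: "nat \<Rightarrow> nat \<Rightarrow> real"
  assumes C: "\<And>m j. \<lbrakk>1 \<le> m; 1 \<le> j\<rbrakk> \<Longrightarrow>
      (\<Sum>i=1..m. 2 * zetabar (2*m - 2*i) * M i j) = (\<Sum>i=1..j. 2 * zetabar (2*j - 2*i) * M i m)"
    and "1 \<le> m" "1 \<le> p"
  shows "(\<Sum>j=1..p. M m j * Zc j p) = (\<Sum>j=1..m. M p j * Zc j m)"
proof -
  define C where "C m j = (\<Sum>i=1..m. 2 * zetabar (2*m - 2*i) * M i j)" for m j
  have M: "M q j = (\<Sum>m=1..q. Zc m q * C m j)" if "1 \<le> q" for q j
  proof -
    have "(\<Sum>m=1..q. Zc m q * C m j)
        = (\<Sum>m=1..q. \<Sum>i=1..m. 2 * zetabar (2*m - 2*i) * Zc m q * M i j)"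
      unfolding C_def by (simp add: sum_distrib_left mult_ac)
    also have "\<dots> = (\<Sum>i=1..q. \<Sum>m=i..q. 2 * zetabar (2*m - 2*i) * Zc m q * M i j)"
      by (simp add: sum.Sigma, rule sum.reindex_bij_witness[of _ prod.swap prod.swap]) auto
    also have "\<dots> = (\<Sum>i=1..q. (if i = q then 1 else 0) * M i j)"
      using Zc_inverse by (intro sum.cong refl) (simp flip: sum_distrib_right)
    also have "\<dots> = M q j"
      using that by (simp add: if_distrib[of "\<lambda>x. x * _"] cong: if_cong)
    finally show ?thesis by simp
  qed
  have "(\<Sum>j=1..p. M m j * Zc j p) = (\<Sum>j=1..p. \<Sum>i=1..m. Zc i m * C i j * Zc j p)"
    using assms by (simp add: M sum_distrib_right)
  also have "\<dots> = (\<Sum>i=1..m. \<Sum>j=1..p. Zc i m * C i j * Zc j p)"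
    by (rule sum.swap)
  also have "\<dots> = (\<Sum>i=1..m. \<Sum>j=1..p. Zc j p * C j i * Zc i m)"
    using C by (intro sum.cong refl) (simp add: C_def mult_ac)
  also have "\<dots> = (\<Sum>j=1..m. M p j * Zc j m)"
    using assms by (simp add: M sum_distrib_right)
  finally show ?thesis .
qed

section \<open>Iterated integrals for alternating T-values\<close>

text \<open>The kernel of \<open>(k+1)\<close>-fold integration from \<open>v\<close> to infinity is
  \<open>cut_monom k (w - v)\<close>. The cutoff lets every integral run over the whole real
  line.\<close>

definition cut_monom :: "nat \<Rightarrow> real \<Rightarrow> real" where
  "cut_monom k x = (if x < 0 then 0 else x ^ k / fact k)"

lemma cut_monom_nonneg [simp]: "0 \<le> cut_monom k x"
  by (simp add: cut_monom_def)

lemma cut_monom_measurable [measurable]: "cut_monom k \<in> borel_measurable borel"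
  by (simp add: cut_monom_def[abs_def])

text \<open>After the shift \<open>w = v + x\<close> the integrand is a constant times the Erlang
  density of shape \<open>k + 1\<close> and rate \<open>a\<close>, which has mass 1.\<close>

lemma has_bochner_integral_cut_monom_exp:
  assumes "a > 0"
  shows "has_bochner_integral lborel (\<lambda>w. cut_monom k (w - v) * exp (- (a * w)))
           (exp (- (a * v)) / a ^ Suc k)"
proof (rule has_bochner_integral_nn_integral)
  have "(\<integral>\<^sup>+ w. ennreal (cut_monom k (w - v) * exp (- (a * w))) \<partial>lborel)
      = (\<integral>\<^sup>+ x. ennreal (cut_monom k x * exp (- (a * (v + x)))) \<partial>lborel)"
    by (subst nn_integral_real_affine[where c = 1 and t = v]) simp_all
  also have "\<dots> = (\<integral>\<^sup>+ x. ennreal (exp (- (a * v)) / a ^ Suc k) * ennreal (erlang_density k a x) \<partial>lborel)"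
    using assms
    by (intro nn_integral_cong)
       (auto simp: cut_monom_def erlang_density_def ring_distribs exp_add exp_minus exp_diff field_simps simp flip: ennreal_mult)
  also have "\<dots> = ennreal (exp (- (a * v)) / a ^ Suc k)"
    using assms nn_integral_erlang_ith_moment[OF assms, where k=k and i=0]
    by (subst nn_integral_cmult) auto
  finally show "(\<integral>\<^sup>+ w. ennreal (cut_monom k (w - v) * exp (- (a * w))) \<partial>lborel)
      = ennreal (exp (- (a * v)) / a ^ Suc k)" .
qed (use assms in auto)

lemmas integrable_cut_monom_exp = has_bochner_integral_cut_monom_exp[THEN integrable.intros]
lemmas integral_cut_monom_exp = has_bochner_integral_cut_monom_exp[THEN has_bochner_integral_integral_eq]

lemma integrable_cut_monom_bounded:
  assumes [measurable]: "f \<in> borel_measurable borel" and "a > 0"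
    and bd: "\<And>w. v \<le> w \<Longrightarrow> \<bar>f w\<bar> \<le> B * exp (- (a * w))"
  shows "integrable lborel (\<lambda>w. cut_monom k (w - v) * f w)"
proof (rule Bochner_Integration.integrable_bound)
  show "integrable lborel (\<lambda>w. B * (cut_monom k (w - v) * exp (- (a * w))))"
    using integrable_cut_monom_exp[OF \<open>a > 0\<close>] by simp
  show "AE w in lborel. norm (cut_monom k (w - v) * f w) \<le> norm (B * (cut_monom k (w - v) * exp (- (a * w))))"
  proof (rule AE_I2)
    fix w
    show "norm (cut_monom k (w - v) * f w) \<le> norm (B * (cut_monom k (w - v) * exp (- (a * w))))"
    proof (cases "v \<le> w")
      case True
      have "cut_monom k (w - v) * \<bar>f w\<bar> \<le> cut_monom k (w - v) * (B * exp (- (a * w)))"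
        using bd[OF True] by (intro mult_left_mono) auto
      also have "\<dots> \<le> \<bar>\<dots>\<bar>" by (rule abs_ge_self)
      finally show ?thesis by (simp add: abs_mult mult_ac)
    qed (simp add: cut_monom_def)
  qed
qed simp

lemma integral_cut_monom_bounded:
  assumes [measurable]: "f \<in> borel_measurable borel" and "a > 0"
    and bd: "\<And>w. v \<le> w \<Longrightarrow> \<bar>f w\<bar> \<le> B * exp (- (a * w))"
  shows "\<bar>\<integral>w. cut_monom k (w - v) * f w \<partial>lborel\<bar> \<le> B * (exp (- (a * v)) / a ^ Suc k)"
proof -
  have "\<bar>\<integral>w. cut_monom k (w - v) * f w \<partial>lborel\<bar> \<le> (\<integral>w. \<bar>cut_monom k (w - v) * f w\<bar> \<partial>lborel)"
    by (rule integral_abs_bound)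
  also have "\<dots> \<le> (\<integral>w. B * (cut_monom k (w - v) * exp (- (a * w))) \<partial>lborel)"
  proof (rule integral_mono)
    show "integrable lborel (\<lambda>w. \<bar>cut_monom k (w - v) * f w\<bar>)"
      using integrable_cut_monom_bounded[OF assms] by simp
    show "integrable lborel (\<lambda>w. B * (cut_monom k (w - v) * exp (- (a * w))))"
      using integrable_cut_monom_exp[OF \<open>a > 0\<close>] by simp
    fix w
    show "\<bar>cut_monom k (w - v) * f w\<bar> \<le> B * (cut_monom k (w - v) * exp (- (a * w)))"
    proof (cases "v \<le> w")
      case True
      have "cut_monom k (w - v) * \<bar>f w\<bar> \<le> cut_monom k (w - v) * (B * exp (- (a * w)))"
        using bd[OF True] by (intro mult_left_mono) auto
      then show ?thesis by (simp add: abs_mult mult_ac)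
    qed (simp add: cut_monom_def)
  qed
  also have "\<dots> = B * (exp (- (a * v)) / a ^ Suc k)"
    using integral_cut_monom_exp[OF \<open>a > 0\<close>] by simp
  finally show ?thesis .
qed

text \<open>This is \<open>1 / (2 * cosh w)\<close>, written as the closed form of the alternating
  geometric series with terms \<open>(-1) ^ n * exp (- ((2 * n + 1) * w))\<close>.\<close>

definition half_sech :: "real \<Rightarrow> real" where
  "half_sech w = exp (- w) / (1 + exp (- (2 * w)))"

lemma half_sech_measurable [measurable]: "half_sech \<in> borel_measurable borel"
  by (simp add: half_sech_def[abs_def])

lemma half_sech_pos: "0 < half_sech w"
  by (simp add: half_sech_def add_pos_pos)

lemma half_sech_nonneg [simp]: "0 \<le> half_sech w"
  using half_sech_pos[of w] by simp

lemma half_sech_le: "half_sech w \<le> exp (- w)"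
  by (simp add: half_sech_def field_simps add_pos_pos)

text \<open>
  Here and in \<open>nested_sum\<close> and \<open>alt_nested_sum\<close> the index list is reversed: its head is the exponent
  of the largest summation variable. Summands with \<open>n \<le> length ks\<close>, whose denominator may vanish or
  be negative, contribute 0 because \<open>nested_sum ks (n - 1) = 0\<close>.
\<close>
fun iter_integral :: "nat list \<Rightarrow> real \<Rightarrow> real" where
  "iter_integral [] v = 1"
| "iter_integral (k # ks) v = (\<integral>w. cut_monom (k - 1) (w - v) * (half_sech w * iter_integral ks w) \<partial>lborel)"

lemma iter_integral_measurable [measurable]: "iter_integral ks \<in> borel_measurable borel"
proof (induction ks)
  case (Cons k ks)
  note [measurable] = Cons.IH
  have "(\<lambda>v. \<integral>w. cut_monom (k - 1) (w - v) * (half_sech w * iter_integral ks w) \<partial>lborel) \<in> borel_measurable borel"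
    by measurable
  then show ?case by (simp add: iter_integral.simps[abs_def])
qed (simp add: iter_integral.simps[abs_def])

lemma iter_integral_nonneg: "0 \<le> iter_integral ks v"
  by (induction ks arbitrary: v) (auto intro!: integral_nonneg)

text \<open>Since \<open>half_sech w \<le> exp (- w)\<close>, each level is at most the integral of
  the kernel against \<open>exp (- w)\<close>, which is \<open>exp (- v) \<le> 1\<close>.\<close>

lemma iter_integral_le_1: "0 \<le> v \<Longrightarrow> iter_integral ks v \<le> 1"
proof (induction ks arbitrary: v)
  case (Cons k ks)
  have "\<bar>iter_integral (k # ks) v\<bar> \<le> 1 * (exp (- (1 * v)) / 1 ^ Suc (k - 1))"
    unfolding iter_integral.simps
  proof (rule integral_cut_monom_bounded)
    fix w assume "v \<le> w"
    then have "iter_integral ks w \<le> 1" using Cons by auto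
    then show "\<bar>half_sech w * iter_integral ks w\<bar> \<le> 1 * exp (- (1 * w))"
      using half_sech_le[of w] iter_integral_nonneg[of ks w] mult_mono[of "half_sech w" "exp (- w)" "iter_integral ks w" 1]
      by (simp add: abs_mult)
  qed simp_all
  also have "\<dots> \<le> 1" using Cons.prems by simp
  finally show ?case by simp
qed simp

lemma half_sech_iter_integral_bound: "0 \<le> w \<Longrightarrow> \<bar>half_sech w * iter_integral ks w\<bar> \<le> 1 * exp (- (1 * w))"
  using half_sech_le[of w] iter_integral_nonneg[of ks w] iter_integral_le_1[of w ks] mult_mono[of "half_sech w" "exp (- w)" "iter_integral ks w" 1]
  by (simp add: abs_mult)

section \<open>Truncated nested sums: growth and exponential damping\<close>

fun nested_sum :: "nat list \<Rightarrow> nat \<Rightarrow> real" where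
  "nested_sum [] N = 1"
| "nested_sum (k # ks) N = (\<Sum>n=1..N. nested_sum ks (n - 1) / (2 * real n - real (length ks + 1)) ^ k)"

fun alt_nested_sum :: "nat list \<Rightarrow> nat \<Rightarrow> real \<Rightarrow> real" where
  "alt_nested_sum [] N w = 1"
| "alt_nested_sum (k # ks) N w = (\<Sum>n=1..N. (-1) ^ n * exp (- ((2 * real n - real (length ks + 1)) * w)) *
     (nested_sum ks (n - 1) / (2 * real n - real (length ks + 1)) ^ k))"

lemma alt_nested_sum_measurable [measurable]: "alt_nested_sum ks N \<in> borel_measurable borel"
  by (cases ks) (simp_all add: alt_nested_sum.simps[abs_def])

lemma nested_sum_eq_0: "n < length ks \<Longrightarrow> nested_sum ks n = 0"
proof (induction ks arbitrary: n)
  case (Cons k ks)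
  then show ?case by (auto intro!: sum.neutral)
qed simp

lemma nested_sum_nonneg: "0 \<le> nested_sum ks n"
proof (induction ks arbitrary: n)
  case (Cons k ks)
  show ?case unfolding nested_sum.simps
  proof (intro sum_nonneg)
    fix i assume i: "i \<in> {1..n}"
    show "0 \<le> nested_sum ks (i - 1) / (2 * real i - real (length ks + 1)) ^ k"
    proof (cases "i - 1 < length ks")
      case False
      then show ?thesis using Cons.IH[of "i - 1"] i by (intro divide_nonneg_nonneg zero_le_power) auto
    qed (simp add: nested_sum_eq_0)
  qed
qed simp

lemma nested_sum_mono: "m \<le> n \<Longrightarrow> nested_sum ks m \<le> nested_sum ks n"
proof (cases ks)
  case (Cons k ks')
  assume "m \<le> n"
  show ?thesis unfolding Cons nested_sum.simps
  proof (intro sum_mono2)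
    fix i assume i: "i \<in> {1..n} - {1..m}"
    show "0 \<le> nested_sum ks' (i - 1) / (2 * real i - real (length ks' + 1)) ^ k"
    proof (cases "i - 1 < length ks'")
      case False
      then show ?thesis
        using nested_sum_nonneg[of ks' "i - 1"] i by (intro divide_nonneg_nonneg zero_le_power) auto
    qed (simp add: nested_sum_eq_0)
  qed (use \<open>m \<le> n\<close> in auto)
qed simp

text \<open>A nonzero summand has \<open>n \<ge> length ks + 1\<close>, so its denominator is a
  positive power of a number that is at least \<open>n\<close>. Each level therefore costs at most
  one factor \<open>harm N\<close>, a logarithmic growth that the gain \<open>1 / N\<close> in the
  truncation error outweighs.\<close>

lemma nested_sum_le_harm:
  assumes "\<forall>k\<in>set ks. 0 < k"
  shows "nested_sum ks N \<le> harm N ^ length ks"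
  using assms
proof (induction ks)
  case (Cons k ks)
  have "nested_sum (k # ks) N \<le> (\<Sum>n=1..N. nested_sum ks N * inverse (real n))"
    unfolding nested_sum.simps
  proof (intro sum_mono)
    fix n assume n: "n \<in> {1..N}"
    show "nested_sum ks (n - 1) / (2 * real n - real (length ks + 1)) ^ k \<le> nested_sum ks N * inverse (real n)"
    proof (cases "n - 1 < length ks")
      case True
      then show ?thesis using nested_sum_nonneg[of ks N] by (simp add: nested_sum_eq_0)
    next
      case False
      let ?a = "2 * real n - real (length ks + 1)"
      have a: "real n \<le> ?a" "1 \<le> ?a" using False n by auto
      then have "?a ^ 1 \<le> ?a ^ k" using Cons.prems by (intro power_increasing) auto
      then have "real n \<le> ?a ^ k" using a by simp
      then have "nested_sum ks (n - 1) / ?a ^ k \<le> nested_sum ks N / real n"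
        using nested_sum_mono[of "n - 1" N ks] nested_sum_nonneg[of ks] n by (intro frac_le) auto
      then show ?thesis by (simp add: field_simps)
    qed
  qed
  also have "\<dots> = nested_sum ks N * harm N"
    by (simp add: harm_def sum_distrib_left)
  also have "\<dots> \<le> harm N ^ length ks * harm N"
    using Cons by (intro mult_right_mono harm_nonneg) auto
  finally show ?case by (simp add: mult_ac)
qed simp

lemma harm_le_ln: "0 < n \<Longrightarrow> harm n \<le> 1 + ln (real n)"
proof (induction n rule: nat_induct_non_zero)
  case (Suc n)
  have "1 / real (Suc n) \<le> ln (real (Suc n)) - ln (real n)"
    using ln_diff_le[of "real n" "real (Suc n)"] Suc by (simp add: field_simps)
  then show ?case using Suc by (simp add: harm_Suc inverse_eq_divide)
qed (simp add: harm_def)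

lemma harm_power_over_n_tendsto_0: "(\<lambda>n. harm n ^ r / real n :: real) \<longlonglongrightarrow> 0"
proof (rule tendsto_sandwich[of "\<lambda>_. 0" _ _ "\<lambda>n. (1 + ln (real n)) ^ r / real n"])
  show "\<forall>\<^sub>F n in sequentially. harm n ^ r / real n \<le> (1 + ln (real n)) ^ r / real n"
    using eventually_gt_at_top[of 0]
    by eventually_elim (intro divide_right_mono power_mono harm_le_ln harm_nonneg, auto)
  show "(\<lambda>n. (1 + ln (real n)) ^ r / real n) \<longlonglongrightarrow> 0"
    by real_asymp
qed (auto intro!: always_eventually divide_nonneg_nonneg zero_le_power harm_nonneg)

text \<open>A geometric series, summed from \<open>n\<close> to \<open>N\<close> for each inner index \<open>n\<close>; the truncation error is kept
  because it carries the conditional convergence.\<close>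
lemma alternating_sum_nested_sum:
  "(\<Sum>n=1..N. (-1) ^ n * exp (- ((2 * real n - real (length ks + 1)) * w)) * nested_sum ks (n - 1))
   = - (half_sech w * (alt_nested_sum ks N w - (-1) ^ N * exp (- ((2 * real N - real (length ks)) * w)) * nested_sum ks N))"
proof (induction N)
  case 0
  show ?case by (cases ks) auto
next
  case (Suc N)
  let ?e = "\<lambda>x. exp (- (x * w))"
  let ?l = "real (length ks)"
  have alt_nested_sum: "alt_nested_sum ks (Suc N) w = alt_nested_sum ks N w + (-1) ^ Suc N * ?e (2 * real (Suc N) - ?l) * (nested_sum ks (Suc N) - nested_sum ks N)"
    by (cases ks) (simp_all add: algebra_simps)
  have e1: "?e (2 * real (Suc N) - real (length ks + 1)) = exp (-w) * ?e (2 * real N - ?l)"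
    by (simp add: algebra_simps flip: exp_add)
  have e2: "?e (2 * real (Suc N) - ?l) = exp (-(2*w)) * ?e (2 * real N - ?l)"
    by (simp add: algebra_simps flip: exp_add)
  have r: "half_sech w * (1 + exp (-(2*w))) = exp (-w)"
    by (simp add: half_sech_def add_pos_pos less_imp_neq[symmetric])
  have "(\<Sum>n=1..Suc N. (-1) ^ n * ?e (2 * real n - real (length ks + 1)) * nested_sum ks (n - 1))
     = - (half_sech w * (alt_nested_sum ks N w - (-1) ^ N * ?e (2 * real N - ?l) * nested_sum ks N))
       + (-1) ^ Suc N * (half_sech w * (1 + exp (-(2*w))) * ?e (2 * real N - ?l)) * nested_sum ks N"
    using Suc by (simp add: r e1[simplified])
  also have "\<dots> = - (half_sech w * (alt_nested_sum ks (Suc N) w - (-1) ^ Suc N * ?e (2 * real (Suc N) - ?l) * nested_sum ks (Suc N)))"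
    unfolding alt_nested_sum e2 by (simp add: algebra_simps)
  finally show ?case .
qed

text \<open>Integration against the kernel turns each \<open>exp (- (a * w))\<close> into
  \<open>exp (- (a * v)) / a ^ k\<close>, which supplies the power in the outermost
  denominator.\<close>

lemma alt_nested_sum_Cons_integral:
  assumes "0 < k"
  shows "has_bochner_integral lborel
     (\<lambda>w. cut_monom (k - 1) (w - v) * (\<Sum>n=1..N. (-1) ^ n * exp (- ((2 * real n - real (length ks + 1)) * w)) * nested_sum ks (n - 1)))
     (alt_nested_sum (k # ks) N v)"
proof -
  have "has_bochner_integral lborel
     (\<lambda>w. \<Sum>n=1..N. (-1) ^ n * nested_sum ks (n - 1) * (cut_monom (k - 1) (w - v) * exp (- ((2 * real n - real (length ks + 1)) * w))))
     (\<Sum>n=1..N. (-1) ^ n * nested_sum ks (n - 1) *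
        (exp (- ((2 * real n - real (length ks + 1)) * v)) / (2 * real n - real (length ks + 1)) ^ k))"
  proof (rule has_bochner_integral_sum)
    fix n assume n: "n \<in> {1..N}"
    show "has_bochner_integral lborel
       (\<lambda>w. (-1) ^ n * nested_sum ks (n - 1) * (cut_monom (k - 1) (w - v) * exp (- ((2 * real n - real (length ks + 1)) * w))))
       ((-1) ^ n * nested_sum ks (n - 1) *
        (exp (- ((2 * real n - real (length ks + 1)) * v)) / (2 * real n - real (length ks + 1)) ^ k))"
    \<comment> \<open>The integral formula needs a positive rate. Where the rate may fail to be
      positive, \<open>nested_sum ks (n - 1)\<close> is 0.\<close>
    proof (cases "n - 1 < length ks")
      case True
      then show ?thesis by (simp add: nested_sum_eq_0 has_bochner_integral_zero)
    next
      case False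
      then have "0 < 2 * real n - real (length ks + 1)" using n by auto
      from has_bochner_integral_mult_right[OF has_bochner_integral_cut_monom_exp[OF this, of "k - 1" v]]
      show ?thesis using assms by simp
    qed
  qed
  then show ?thesis by (simp add: sum_distrib_left mult_ac)
qed

text \<open>The inner error must be uniform in \<open>v \<ge> 0\<close> in order to be integrated at
  the next level; the kernel times \<open>exp (- w)\<close> has mass
  \<open>exp (- v) \<le> 1\<close>, so it does not grow there. Each level adds only the truncation
  error of the geometric series, at most \<open>harm N ^ L / N\<close> for a tail of length
  \<open>L\<close>. This tends to 0 even at \<open>v = 0\<close>, where the exponential gives no
  decay.\<close>

lemma alt_nested_sum_uniform_limit:
  assumes "\<forall>k\<in>set ks. 0 < k"
  shows "\<exists>\<epsilon>. \<epsilon> \<longlonglongrightarrow> 0 \<and>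
     (\<forall>N\<ge>length ks. \<forall>v\<ge>0. \<bar>alt_nested_sum ks N v - (-1) ^ length ks * iter_integral ks v\<bar> \<le> \<epsilon> N)"
  using assms
proof (induction ks)
  case Nil
  show ?case by (intro exI[of _ "\<lambda>_. 0"]) auto
next
  case (Cons k ks)
  then obtain \<epsilon> where \<epsilon>: "\<epsilon> \<longlonglongrightarrow> 0"
    and bd: "\<And>N v. \<lbrakk>length ks \<le> N; 0 \<le> v\<rbrakk> \<Longrightarrow> \<bar>alt_nested_sum ks N v - (-1) ^ length ks * iter_integral ks v\<bar> \<le> \<epsilon> N"
    by auto
  define L where "L = length ks"
  have "\<bar>alt_nested_sum (k # ks) N v - (-1) ^ length (k # ks) * iter_integral (k # ks) v\<bar> \<le> \<epsilon> N + harm N ^ L / real N"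
    if N: "Suc L \<le> N" and v: "0 \<le> v" for N v
  proof -
    \<comment> \<open>Decay rate of the truncation term: \<open>2 N - L\<close> from its own
      exponential and 1 from \<open>half_sech w \<le> exp (- w)\<close>. It is at least
      \<open>N\<close>, so the integration gains a factor \<open>1 / N\<close>.\<close>
    define a where "a = 2 * real N - real L + 1"
    have a: "real N \<le> a" "1 \<le> a" using N by (auto simp: a_def)
    \<comment> \<open>\<open>X\<close> carries the inner error and \<open>Y\<close> the truncation
      term; the integral that remains is \<open>iter_integral (k # ks) v\<close> up to sign.\<close>
    define X where "X w = - (half_sech w * (alt_nested_sum ks N w - (-1) ^ L * iter_integral ks w))" for w
    define Y where "Y w = half_sech w * ((-1) ^ N * exp (- ((2 * real N - real L) * w)) * nested_sum ks N)" for w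
    have [measurable]: "X \<in> borel_measurable borel" "Y \<in> borel_measurable borel"
      unfolding X_def[abs_def] Y_def[abs_def] by measurable
    have X: "\<bar>X w\<bar> \<le> \<epsilon> N * exp (- (1 * w))" if "v \<le> w" for w
    proof -
      have "half_sech w * \<bar>alt_nested_sum ks N w - (-1) ^ L * iter_integral ks w\<bar> \<le> exp (- w) * \<epsilon> N"
        using bd[of N w] that v N half_sech_le[of w] by (intro mult_mono) (auto simp: L_def)
      then show ?thesis by (simp add: X_def abs_mult mult_ac)
    qed
    have Y: "\<bar>Y w\<bar> \<le> nested_sum ks N * exp (- (a * w))" for w
    proof -
      have "\<bar>Y w\<bar> = half_sech w * (exp (- ((2 * real N - real L) * w)) * nested_sum ks N)"
        using nested_sum_nonneg[of ks N] by (simp add: Y_def abs_mult)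
      also have "\<dots> \<le> exp (- w) * (exp (- ((2 * real N - real L) * w)) * nested_sum ks N)"
        using half_sech_le[of w] nested_sum_nonneg[of ks N] by (intro mult_right_mono) auto
      also have "exp (- w) * (exp (- ((2 * real N - real L) * w)) * nested_sum ks N) = nested_sum ks N * exp (- (a * w))"
      proof -
        have "exp (- (a * w)) = exp (- w) * exp (- ((2 * real N - real L) * w))"
          by (simp add: a_def algebra_simps flip: exp_add)
        then show ?thesis by (simp only: mult_ac)
      qed
      finally show ?thesis .
    qed
    have \<epsilon>0: "0 \<le> \<epsilon> N" using bd[of N 0] N by (auto simp: L_def)
    let ?K = "\<lambda>w. cut_monom (k - 1) (w - v)"
    have iX: "integrable lborel (\<lambda>w. ?K w * X w)"
      by (rule integrable_cut_monom_bounded[OF _ _ X]) auto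
    have iY: "integrable lborel (\<lambda>w. ?K w * Y w)"
      by (rule integrable_cut_monom_bounded[OF _ _ Y]) (use a in auto)
    have iJ: "integrable lborel (\<lambda>w. ?K w * (half_sech w * iter_integral ks w))"
      by (rule integrable_cut_monom_bounded[OF _ _ half_sech_iter_integral_bound]) (use v in auto)
    have "alt_nested_sum (k # ks) N v = (\<integral>w. ?K w * - (half_sech w * (alt_nested_sum ks N w -
            (-1) ^ N * exp (- ((2 * real N - real (length ks)) * w)) * nested_sum ks N)) \<partial>lborel)"
      using alt_nested_sum_Cons_integral[of k v ks N] Cons.prems unfolding alternating_sum_nested_sum
      by (intro has_bochner_integral_integral_eq[symmetric]) auto
    also have "\<dots> = (\<integral>w. ?K w * X w + ?K w * Y w - (-1) ^ L * (?K w * (half_sech w * iter_integral ks w)) \<partial>lborel)"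
      by (intro Bochner_Integration.integral_cong refl) (simp add: X_def Y_def L_def algebra_simps)
    also have "\<dots> = (\<integral>w. ?K w * X w \<partial>lborel) + (\<integral>w. ?K w * Y w \<partial>lborel) - (-1) ^ L * iter_integral (k # ks) v"
      using iX iY iJ by simp
    finally have "alt_nested_sum (k # ks) N v - (-1) ^ length (k # ks) * iter_integral (k # ks) v
        = (\<integral>w. ?K w * X w \<partial>lborel) + (\<integral>w. ?K w * Y w \<partial>lborel)"
      by (simp add: L_def del: iter_integral.simps alt_nested_sum.simps)
    moreover have "\<bar>\<integral>w. ?K w * X w \<partial>lborel\<bar> \<le> \<epsilon> N"
    proof -
      have "\<bar>\<integral>w. ?K w * X w \<partial>lborel\<bar> \<le> \<epsilon> N * (exp (- (1 * v)) / 1 ^ Suc (k - 1))"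
        by (rule integral_cut_monom_bounded[OF _ _ X]) auto
      also have "\<dots> \<le> \<epsilon> N * 1" using \<epsilon>0 v by (intro mult_left_mono) auto
      finally show ?thesis by simp
    qed
    moreover have "\<bar>\<integral>w. ?K w * Y w \<partial>lborel\<bar> \<le> harm N ^ L / real N"
    proof -
      have "real N \<le> a ^ Suc (k - 1)"
        using a(1) power_increasing[OF _ a(2), of 1 "Suc (k - 1)"] by (simp del: power_Suc)
      then have 1: "1 / a ^ Suc (k - 1) \<le> 1 / real N"
        using N by (intro divide_left_mono) auto
      have "\<bar>\<integral>w. ?K w * Y w \<partial>lborel\<bar> \<le> nested_sum ks N * (exp (- (a * v)) / a ^ Suc (k - 1))"
        by (rule integral_cut_monom_bounded[OF _ _ Y]) (use a in auto)
      also have "\<dots> \<le> nested_sum ks N * (1 / a ^ Suc (k - 1))"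
        using a v nested_sum_nonneg[of ks N] by (intro mult_left_mono divide_right_mono) auto
      also have "\<dots> \<le> harm N ^ L * (1 / real N)"
        using 1 nested_sum_le_harm[of ks N] Cons.prems a
        by (intro mult_mono) (auto simp: L_def harm_nonneg)
      finally show ?thesis by simp
    qed
    ultimately show ?thesis by linarith
  qed
  moreover have "(\<lambda>N. \<epsilon> N + harm N ^ L / real N) \<longlonglongrightarrow> 0"
    using tendsto_add[OF \<epsilon> harm_power_over_n_tendsto_0[of L]] by simp
  ultimately show ?case
    by (intro exI[of _ "\<lambda>N. \<epsilon> N + harm N ^ L / real N"]) (auto simp: L_def simp del: iter_integral.simps alt_nested_sum.simps)
qed

section \<open>Partial sums of T-values as nested sums\<close>

definition incr_lists :: "nat \<Rightarrow> nat \<Rightarrow> nat list set" where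
  "incr_lists r N = {ns. length ns = r \<and> sorted_wrt (<) ns \<and> set ns \<subseteq> {1..N}}"

lemma finite_incr_lists: "finite (incr_lists r N)"
  unfolding incr_lists_def
  by (rule finite_subset[OF _ finite_lists_length_eq[of "{1..N}" r]]) auto

lemma incr_lists_0: "incr_lists 0 N = {[]}"
  by (auto simp: incr_lists_def)

lemma incr_lists_Suc:
  "incr_lists (Suc r) N = (\<Union>n\<in>{1..N}. (\<lambda>ns. ns @ [n]) ` incr_lists r (n - 1))" (is "?L = ?R")
proof (intro equalityI subsetI)
  fix xs assume xs: "xs \<in> ?L"
  then obtain ns n where ns: "xs = ns @ [n]" "length ns = r"
    by (cases xs rule: rev_cases) (auto simp: incr_lists_def)
  have "x \<in> {1..n - 1}" if "x \<in> set ns" for x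
  proof -
    have "x < n" "x \<in> {1..N}"
      using xs ns that by (auto simp: incr_lists_def sorted_wrt_append)
    then show ?thesis by auto
  qed
  then have "ns \<in> incr_lists r (n - 1)" "n \<in> {1..N}"
    using xs ns by (auto simp: incr_lists_def sorted_wrt_append)
  then show "xs \<in> ?R" using ns by blast
next
  fix xs assume "xs \<in> ?R"
  then obtain ns n where n: "n \<in> {1..N}" and ns: "ns \<in> incr_lists r (n - 1)" and xs: "xs = ns @ [n]"
    by blast
  have "x < n \<and> x \<in> {1..N}" if "x \<in> set ns" for x
  proof -
    have "x \<in> {1..n - 1}" using ns that by (auto simp: incr_lists_def)
    then show ?thesis using n by auto
  qed
  then show "xs \<in> ?L"
    using n ns xs by (auto simp: incr_lists_def sorted_wrt_append)
qed

lemma sum_incr_lists_Suc: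
  "(\<Sum>ns\<in>incr_lists (Suc r) N. f ns) = (\<Sum>n=1..N. \<Sum>ns\<in>incr_lists r (n - 1). f (ns @ [n]))"
proof -
  have "(\<Sum>ns\<in>incr_lists (Suc r) N. f ns)
      = (\<Sum>n=1..N. \<Sum>ns\<in>(\<lambda>ns. ns @ [n]) ` incr_lists r (n - 1). f ns)"
    unfolding incr_lists_Suc by (rule sum.UNION_disjoint) (auto intro: finite_incr_lists)
  also have "\<dots> = (\<Sum>n=1..N. \<Sum>ns\<in>incr_lists r (n - 1). f (ns @ [n]))"
    by (rule sum.cong[OF refl]) (simp add: sum.reindex inj_on_def)
  finally show ?thesis .
qed

lemma prod_snoc:
  fixes g :: "nat \<Rightarrow> nat \<Rightarrow> nat \<Rightarrow> 'a :: comm_monoid_mult"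
  assumes "length ns = length ks"
  shows "(\<Prod>i<length (ks @ [k]). g i ((ns @ [n]) ! i) ((ks @ [k]) ! i))
    = (\<Prod>i<length ks. g i (ns ! i) (ks ! i)) * g (length ks) n k"
proof -
  have "(\<Prod>i<length ks. g i ((ns @ [n]) ! i) ((ks @ [k]) ! i)) = (\<Prod>i<length ks. g i (ns ! i) (ks ! i))"
    using assms by (intro prod.cong) (auto simp: nth_append)
  then show ?thesis using assms by (simp add: nth_append lessThan_Suc mult_ac)
qed

text \<open>Induction from the right: the largest summation variable belongs to the last exponent,
  which is the head of the reversed list.\<close>

lemma nested_sum_rev_eq_sum:
  "nested_sum (rev ks) N = (\<Sum>ns\<in>incr_lists (length ks) N.
      1 / (\<Prod>i<length ks. (2 * real (ns ! i) - real (i + 1)) ^ (ks ! i)))"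
proof (induction ks arbitrary: N rule: rev_induct)
  case Nil
  show ?case by (simp add: incr_lists_0)
next
  case (snoc k ks)
  have "(\<Sum>ns\<in>incr_lists (length (ks @ [k])) N.
      1 / (\<Prod>i<length (ks @ [k]). (2 * real (ns ! i) - real (i + 1)) ^ ((ks @ [k]) ! i)))
    = (\<Sum>n=1..N. \<Sum>ns\<in>incr_lists (length ks) (n - 1).
      1 / (\<Prod>i<length (ks @ [k]). (2 * real ((ns @ [n]) ! i) - real (i + 1)) ^ ((ks @ [k]) ! i)))"
    by (simp only: length_append_singleton sum_incr_lists_Suc)
  also have "\<dots> = (\<Sum>n=1..N. \<Sum>ns\<in>incr_lists (length ks) (n - 1).
      1 / (\<Prod>i<length ks. (2 * real (ns ! i) - real (i + 1)) ^ (ks ! i)) /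
        (2 * real n - real (length ks + 1)) ^ k)"
    by (intro sum.cong refl, subst prod_snoc[where g = "\<lambda>i n k. (2 * real n - real (i + 1)) ^ k"])
       (auto simp: incr_lists_def)
  also have "\<dots> = nested_sum (rev (ks @ [k])) N"
    by (simp add: snoc sum_divide_distrib)
  finally show ?case ..
qed

lemma Tbar_partial_eq_alt_nested_sum:
  assumes "ks \<noteq> []"
  shows "Tbar_partial ks N = alt_nested_sum (rev ks) N 0"
proof -
  obtain js k where ks: "ks = js @ [k]" using assms by (cases ks rule: rev_cases) auto
  have "Tbar_partial ks N = (\<Sum>n=1..N. \<Sum>ns\<in>incr_lists (length js) (n - 1). (-1) ^ last (ns @ [n]) /
      (\<Prod>i<length (js @ [k]). (2 * real ((ns @ [n]) ! i) - real (i + 1)) ^ ((js @ [k]) ! i)))"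
    unfolding Tbar_partial_def ks incr_lists_def[symmetric]
    by (simp only: length_append_singleton sum_incr_lists_Suc)
  also have "\<dots> = (\<Sum>n=1..N. \<Sum>ns\<in>incr_lists (length js) (n - 1).
      (-1) ^ n / (2 * real n - real (length js + 1)) ^ k *
      (1 / (\<Prod>i<length js. (2 * real (ns ! i) - real (i + 1)) ^ (js ! i))))"
    by (intro sum.cong refl, subst prod_snoc[where g = "\<lambda>i n k. (2 * real n - real (i + 1)) ^ k"])
       (auto simp: incr_lists_def)
  also have "\<dots> = alt_nested_sum (rev ks) N 0"
    by (simp add: ks nested_sum_rev_eq_sum sum_distrib_left sum_divide_distrib mult_ac)
  finally show ?thesis .
qed

text \<open>At \<open>v = 0\<close> the damping is absent and \<open>alt_nested_sum\<close> is the
  partial sum itself, so the uniform limit shows that the \<open>lim\<close> in \<open>Tbar\<close>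
  is taken of a convergent sequence.\<close>

lemma Tbar_eq_iter_integral:
  assumes "\<forall>k\<in>set ks. 0 < k"
  shows "Tbar ks = (-2) ^ length ks * iter_integral (rev ks) 0"
proof (cases "ks = []")
  case False
  obtain \<epsilon> where \<epsilon>: "\<epsilon> \<longlonglongrightarrow> 0"
    and bd: "\<forall>N\<ge>length (rev ks). \<forall>v\<ge>0. \<bar>alt_nested_sum (rev ks) N v - (-1) ^ length (rev ks) * iter_integral (rev ks) v\<bar> \<le> \<epsilon> N"
    using alt_nested_sum_uniform_limit[of "rev ks"] assms by (auto simp del: length_rev)
  have "(\<lambda>N. alt_nested_sum (rev ks) N 0 - (-1) ^ length ks * iter_integral (rev ks) 0) \<longlonglongrightarrow> 0"
    using bd by (intro Lim_null_comparison[OF _ \<epsilon>] eventually_sequentiallyI[of "length ks"]) auto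
  then have "(\<lambda>N. Tbar_partial ks N) \<longlonglongrightarrow> (-1) ^ length ks * iter_integral (rev ks) 0"
    using False by (simp add: Tbar_partial_eq_alt_nested_sum LIM_zero_iff)
  then have "lim (\<lambda>N. Tbar_partial ks N) = (-1) ^ length ks * iter_integral (rev ks) 0"
    by (rule limI)
  moreover have "(-2::real) ^ length ks = 2 ^ length ks * (-1) ^ length ks"
    by (simp flip: power_mult_distrib)
  ultimately show ?thesis using False by (simp add: Tbar_def)
qed (simp add: Tbar_def)

section \<open>Summation over compositions\<close>

text \<open>Half the Gudermannian function: the antiderivative of \<open>half_sech\<close> that
  vanishes at 0.\<close>

definition half_gd :: "real \<Rightarrow> real" where
  "half_gd w = pi / 4 - arctan (exp (- w))"

lemma half_gd_measurable [measurable]: "half_gd \<in> borel_measurable borel"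
  unfolding half_gd_def[abs_def] by measurable

lemma half_gd_0 [simp]: "half_gd 0 = 0"
  by (simp add: half_gd_def arctan_one)

lemma has_real_derivative_half_gd: "(half_gd has_real_derivative half_sech w) (at w within A)"
proof -
  have "(exp (- w))\<^sup>2 = exp (- (2 * w))"
    by (simp add: power2_eq_square flip: exp_add)
  moreover have "((\<lambda>w. pi / 4 - arctan (exp (- w))) has_real_derivative exp (- w) / (1 + (exp (- w))\<^sup>2)) (at w within A)"
    by (rule derivative_eq_intros refl | simp add: inverse_eq_divide)+
  ultimately show ?thesis
    by (simp add: half_gd_def[abs_def] half_sech_def)
qed

lemma half_gd_mono: "v \<le> w \<Longrightarrow> half_gd v \<le> half_gd w"
  by (simp add: half_gd_def arctan_le_iff)

lemma half_gd_nonneg: "0 \<le> w \<Longrightarrow> 0 \<le> half_gd w"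
  using half_gd_mono[of 0 w] by simp

lemma half_gd_less: "half_gd w < pi / 4"
  by (simp add: half_gd_def zero_less_arctan_iff)

text \<open>The substitution \<open>u = half_gd z - half_gd w\<close> turns the integrand into
  \<open>u ^ r / fact r\<close>.\<close>

lemma nn_integral_half_sech_half_gd:
  assumes "v \<le> z"
  shows "(\<integral>\<^sup>+w. ennreal (half_sech w * cut_monom r (half_gd z - half_gd w)) * indicator {v..z} w \<partial>lborel)
     = ennreal (cut_monom (Suc r) (half_gd z - half_gd v))"
proof -
  define F where "F w = - ((half_gd z - half_gd w) ^ Suc r / fact (Suc r))" for w
  have "(\<integral>\<^sup>+w. ennreal (half_sech w * cut_monom r (half_gd z - half_gd w)) * indicator {v..z} w \<partial>lborel) = ennreal (F z - F v)"
  proof (rule nn_integral_FTC_Icc)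
    fix x assume "x \<in> {v..z}"
    then have x: "v \<le> x" "x \<le> z" by auto
    have "cut_monom r (half_gd z - half_gd x) = (half_gd z - half_gd x) ^ r / fact r"
      using half_gd_mono[OF x(2)] by (simp add: cut_monom_def)
    moreover have "(F has_real_derivative half_sech x * ((half_gd z - half_gd x) ^ r / fact r)) (at x)"
      unfolding F_def[abs_def]
      by (rule derivative_eq_intros has_real_derivative_half_gd refl | simp)+
    ultimately show "(F has_real_derivative half_sech x * cut_monom r (half_gd z - half_gd x)) (at x)" by simp
  qed (use assms in auto)
  also have "F z - F v = cut_monom (Suc r) (half_gd z - half_gd v)"
    using half_gd_mono[OF assms] by (simp add: F_def cut_monom_def)
  finally show ?thesis .
qed

text \<open>The binomial theorem for divided powers of \<open>z - v = (w - v) + (z - w)\<close>; the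
  two cutoffs leave exactly \<open>v \<le> w \<le> z\<close>. This identity collapses the sum over
  compositions.\<close>

lemma sum_cut_monom_binomial:
  "(\<Sum>a\<le>d. cut_monom a (w - v) * cut_monom (d - a) (z - w)) = cut_monom d (z - v) * indicator {v..z} w"
proof (cases "v \<le> w \<and> w \<le> z")
  case True
  have "(z - v) ^ d = ((w - v) + (z - w)) ^ d" by simp
  also have "\<dots> = (\<Sum>a\<le>d. of_nat (d choose a) * (w - v) ^ a * (z - w) ^ (d - a))"
    by (rule binomial_ring)
  finally have "(z - v) ^ d / fact d = (\<Sum>a\<le>d. of_nat (d choose a) * (w - v) ^ a * (z - w) ^ (d - a) / fact d)"
    by (simp add: sum_divide_distrib)
  also have "\<dots> = (\<Sum>a\<le>d. cut_monom a (w - v) * cut_monom (d - a) (z - w))"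
    using True by (intro sum.cong refl) (auto simp: cut_monom_def binomial_fact field_simps)
  finally show ?thesis using True by (simp add: cut_monom_def)
next
  case False
  then show ?thesis by (auto simp: cut_monom_def intro!: sum.neutral)
qed

section \<open>Compositions and the single integral for W\<close>

lemma finite_Icomp: "finite (Icomp k r)"
proof -
  have "Icomp k r \<subseteq> {ks. set ks \<subseteq> {..k} \<and> length ks = r}"
    by (auto simp: Icomp_def dest: member_le_sum_list)
  then show ?thesis by (rule finite_subset) (simp add: finite_lists_length_eq)
qed

lemma Icomp_0: "Icomp k 0 = (if k = 0 then {[]} else {})"
  by (auto simp: Icomp_def)

text \<open>Here \<open>d\<close> is the excess of the weight over its least possible value; the
  first part \<open>Suc a\<close> uses up \<open>a\<close> of it.\<close>

lemma Icomp_Suc: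
  "Icomp (d + Suc r) (Suc r) = (\<Union>a\<in>{..d}. (#) (Suc a) ` Icomp (d - a + r) r)" (is "?L = ?R")
proof (intro equalityI subsetI)
  fix xs assume xs: "xs \<in> ?L"
  then obtain b ks where b: "xs = b # ks" "0 < b" "length ks = r" "\<forall>k\<in>set ks. 0 < k"
      "b + sum_list ks = d + Suc r"
    by (cases xs) (auto simp: Icomp_def)
  have "r \<le> sum_list ks"
    using b(3,4) by (induction ks arbitrary: r) fastforce+
  then have "b - 1 \<le> d" "ks \<in> Icomp (d - (b - 1) + r) r" "xs = Suc (b - 1) # ks"
    using b by (auto simp: Icomp_def)
  then show "xs \<in> ?R" by blast
qed (auto simp: Icomp_def)

lemma sum_Icomp_Suc:
  "(\<Sum>ks\<in>Icomp (d + Suc r) (Suc r). f ks) = (\<Sum>a\<le>d. \<Sum>ks\<in>Icomp (d - a + r) r. f (Suc a # ks))"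
proof -
  have "(\<Sum>ks\<in>Icomp (d + Suc r) (Suc r). f ks) = (\<Sum>a\<le>d. \<Sum>ks\<in>(#) (Suc a) ` Icomp (d - a + r) r. f ks)"
    unfolding Icomp_Suc by (rule sum.UNION_disjoint) (auto intro: finite_Icomp)
  also have "\<dots> = (\<Sum>a\<le>d. \<Sum>ks\<in>Icomp (d - a + r) r. f (Suc a # ks))"
    by (rule sum.cong[OF refl]) (simp add: sum.reindex inj_on_def)
  finally show ?thesis .
qed

lemma ennreal_iter_integral_Cons:
  assumes "0 \<le> v"
  shows "ennreal (iter_integral (Suc a # ks) v) = (\<integral>\<^sup>+w. ennreal (cut_monom a (w - v) * half_sech w) * ennreal (iter_integral ks w) \<partial>lborel)"
proof -
  have "integrable lborel (\<lambda>w. cut_monom a (w - v) * (half_sech w * iter_integral ks w))"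
    by (rule integrable_cut_monom_bounded[OF _ _ half_sech_iter_integral_bound]) (use assms in auto)
  then have "ennreal (iter_integral (Suc a # ks) v) = (\<integral>\<^sup>+w. ennreal (cut_monom a (w - v) * (half_sech w * iter_integral ks w)) \<partial>lborel)"
    by (subst nn_integral_eq_integral) (auto simp: iter_integral_nonneg)
  then show ?thesis
    by (simp add: iter_integral_nonneg mult.assoc flip: ennreal_mult)
qed

text \<open>Induction on the depth. Splitting off the head exponent gives a double integral over
  \<open>w\<close> and \<open>z\<close>; summing over the head merges the two kernels into
  \<open>cut_monom d (z - v)\<close>, which is free of \<open>w\<close>, and the integral over
  \<open>w\<close> then adds one power of \<open>half_gd\<close>. Working in \<open>ennreal\<close>
  makes all exchanges of sums and integrals free.\<close>

lemma sum_Icomp_iter_integral: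
  assumes "0 \<le> v"
  shows "(\<Sum>ks\<in>Icomp (d + Suc r) (Suc r). ennreal (iter_integral ks v))
    = (\<integral>\<^sup>+w. ennreal (cut_monom d (w - v) * half_sech w * cut_monom r (half_gd w - half_gd v)) \<partial>lborel)"
  using assms
proof (induction r arbitrary: d v)
  case 0
  \<comment> \<open>With no parts left the remaining weight must be 0, so only the first part
    \<open>Suc d\<close> survives.\<close>
  have "(\<Sum>ks\<in>Icomp (d + Suc 0) (Suc 0). ennreal (iter_integral ks v))
      = (\<Sum>a\<le>d. if a = d then ennreal (iter_integral [Suc d] v) else 0)"
    unfolding sum_Icomp_Suc by (intro sum.cong refl) (auto simp: Icomp_0 simp del: iter_integral.simps)
  also have "\<dots> = (\<integral>\<^sup>+w. ennreal (cut_monom d (w - v) * half_sech w) * ennreal (iter_integral [] w) \<partial>lborel)"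
    using 0 by (simp add: ennreal_iter_integral_Cons del: iter_integral.simps)
  also have "\<dots> = (\<integral>\<^sup>+w. ennreal (cut_monom d (w - v) * half_sech w * cut_monom 0 (half_gd w - half_gd v)) \<partial>lborel)"
  proof (intro nn_integral_cong)
    fix w
    show "ennreal (cut_monom d (w - v) * half_sech w) * ennreal (iter_integral [] w) = ennreal (cut_monom d (w - v) * half_sech w * cut_monom 0 (half_gd w - half_gd v))"
      using half_gd_mono[of v w] by (cases "v \<le> w") (auto simp: cut_monom_def)
  qed
  finally show ?case .
next
  case (Suc r)
  have "(\<Sum>ks\<in>Icomp (d + Suc (Suc r)) (Suc (Suc r)). ennreal (iter_integral ks v))
     = (\<Sum>a\<le>d. \<Sum>ks\<in>Icomp (d - a + Suc r) (Suc r). \<integral>\<^sup>+w. ennreal (cut_monom a (w - v) * half_sech w) * ennreal (iter_integral ks w) \<partial>lborel)"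
    unfolding sum_Icomp_Suc using Suc.prems by (simp add: ennreal_iter_integral_Cons del: iter_integral.simps)
  also have "\<dots> = (\<Sum>a\<le>d. \<integral>\<^sup>+w. ennreal (cut_monom a (w - v) * half_sech w) *
      (\<Sum>ks\<in>Icomp (d - a + Suc r) (Suc r). ennreal (iter_integral ks w)) \<partial>lborel)"
    by (simp add: nn_integral_sum sum_distrib_left)
  also have "\<dots> = (\<Sum>a\<le>d. \<integral>\<^sup>+w. ennreal (cut_monom a (w - v) * half_sech w) *
      (\<integral>\<^sup>+z. ennreal (cut_monom (d - a) (z - w) * half_sech z * cut_monom r (half_gd z - half_gd w)) \<partial>lborel) \<partial>lborel)"
  proof (intro sum.cong refl nn_integral_cong)
    fix a w
    show "ennreal (cut_monom a (w - v) * half_sech w) * (\<Sum>ks\<in>Icomp (d - a + Suc r) (Suc r). ennreal (iter_integral ks w))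
      = ennreal (cut_monom a (w - v) * half_sech w) *
        (\<integral>\<^sup>+z. ennreal (cut_monom (d - a) (z - w) * half_sech z * cut_monom r (half_gd z - half_gd w)) \<partial>lborel)"
    \<comment> \<open>The induction hypothesis needs \<open>0 \<le> w\<close>, which follows from
      \<open>v \<le> w\<close>; for smaller \<open>w\<close> the kernel vanishes.\<close>
    proof (cases "v \<le> w")
      case True
      then show ?thesis using Suc.IH[of w "d - a"] Suc.prems by simp
    qed (simp add: cut_monom_def)
  qed
  also have "\<dots> = (\<integral>\<^sup>+w. \<integral>\<^sup>+z. (\<Sum>a\<le>d. ennreal (cut_monom a (w - v) * half_sech w) *
      ennreal (cut_monom (d - a) (z - w) * half_sech z * cut_monom r (half_gd z - half_gd w))) \<partial>lborel \<partial>lborel)"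
    by (simp add: nn_integral_sum nn_integral_cmult[symmetric])
  also have "\<dots> = (\<integral>\<^sup>+w. \<integral>\<^sup>+z. ennreal (cut_monom d (z - v) * half_sech z) *
      (ennreal (half_sech w * cut_monom r (half_gd z - half_gd w)) * indicator {v..z} w) \<partial>lborel \<partial>lborel)"
  proof (intro nn_integral_cong)
    fix w z
    have "(\<Sum>a\<le>d. ennreal (cut_monom a (w - v) * half_sech w) * ennreal (cut_monom (d - a) (z - w) * half_sech z * cut_monom r (half_gd z - half_gd w)))
      = ennreal (\<Sum>a\<le>d. cut_monom a (w - v) * half_sech w * (cut_monom (d - a) (z - w) * half_sech z * cut_monom r (half_gd z - half_gd w)))"
      by (subst sum_ennreal[symmetric]) (auto simp: ennreal_mult)
    also have "(\<Sum>a\<le>d. cut_monom a (w - v) * half_sech w * (cut_monom (d - a) (z - w) * half_sech z * cut_monom r (half_gd z - half_gd w)))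
      = half_sech w * half_sech z * cut_monom r (half_gd z - half_gd w) * (\<Sum>a\<le>d. cut_monom a (w - v) * cut_monom (d - a) (z - w))"
      by (simp add: sum_distrib_left mult_ac)
    also have "ennreal \<dots> = ennreal (cut_monom d (z - v) * half_sech z) *
      (ennreal (half_sech w * cut_monom r (half_gd z - half_gd w)) * indicator {v..z} w)"
      unfolding sum_cut_monom_binomial
      by (auto simp: indicator_def mult_ac simp flip: ennreal_mult)
    finally show "(\<Sum>a\<le>d. ennreal (cut_monom a (w - v) * half_sech w) * ennreal (cut_monom (d - a) (z - w) * half_sech z * cut_monom r (half_gd z - half_gd w)))
      = ennreal (cut_monom d (z - v) * half_sech z) * (ennreal (half_sech w * cut_monom r (half_gd z - half_gd w)) * indicator {v..z} w)" .
  qed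
  \<comment> \<open>With \<open>w\<close> as the inner variable, the inner integral is the one
    evaluated by \<open>nn_integral_half_sech_half_gd\<close>.\<close>
  also have "\<dots> = (\<integral>\<^sup>+z. \<integral>\<^sup>+w. ennreal (cut_monom d (z - v) * half_sech z) *
      (ennreal (half_sech w * cut_monom r (half_gd z - half_gd w)) * indicator {v..z} w) \<partial>lborel \<partial>lborel)"
    unfolding indicator_def atLeastAtMost_iff by (rule lborel_pair.Fubini') measurable
  also have "\<dots> = (\<integral>\<^sup>+z. ennreal (cut_monom d (z - v) * half_sech z * cut_monom (Suc r) (half_gd z - half_gd v)) \<partial>lborel)"
  proof (intro nn_integral_cong)
    fix z
    have "(\<integral>\<^sup>+w. ennreal (cut_monom d (z - v) * half_sech z) *
      (ennreal (half_sech w * cut_monom r (half_gd z - half_gd w)) * indicator {v..z} w) \<partial>lborel)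
      = ennreal (cut_monom d (z - v) * half_sech z) *
      (\<integral>\<^sup>+w. ennreal (half_sech w * cut_monom r (half_gd z - half_gd w)) * indicator {v..z} w \<partial>lborel)"
      by (rule nn_integral_cmult) measurable
    also have "\<dots> = ennreal (cut_monom d (z - v) * half_sech z * cut_monom (Suc r) (half_gd z - half_gd v))"
    proof (cases "v \<le> z")
      case True
      then show ?thesis by (simp add: nn_integral_half_sech_half_gd flip: ennreal_mult)
    qed (simp add: cut_monom_def)
    finally show "(\<integral>\<^sup>+w. ennreal (cut_monom d (z - v) * half_sech z) *
      (ennreal (half_sech w * cut_monom r (half_gd z - half_gd w)) * indicator {v..z} w) \<partial>lborel)
      = ennreal (cut_monom d (z - v) * half_sech z * cut_monom (Suc r) (half_gd z - half_gd v))" .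
  qed
  finally show ?case .
qed

text \<open>The case \<open>v = 0\<close> with excess \<open>2*j - 1\<close> and depth
  \<open>2*i\<close>. The even depth makes \<open>(-2) ^ (2*i)\<close> positive; one of its factors
  2 goes to \<open>half_sech\<close>, the other \<open>2*i - 1\<close> to the powers of
  \<open>half_gd\<close>.\<close>

lemma W_eq_integral:
  assumes "1 \<le> i" "1 \<le> j"
  shows "has_bochner_integral lborel
     (\<lambda>w. cut_monom (2*j - 1) w * (2 * half_sech w * ((2 * half_gd w) ^ (2*i - 1) / fact (2*i - 1))))
     (W (2*j + 2*i - 1) (2*i))"
proof -
  let ?S = "Icomp (2*j + 2*i - 1) (2*i)"
  have "W (2*j + 2*i - 1) (2*i) = (\<Sum>ks\<in>?S. (-2) ^ (2*i) * iter_integral (rev ks) 0)"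
    unfolding W_def by (intro sum.cong refl) (auto simp: Icomp_def Tbar_eq_iter_integral)
  \<comment> \<open>\<open>Icomp\<close> is closed under reversal, so the reversed order of the
    exponents does not affect the sum.\<close>
  also have "\<dots> = (\<Sum>ks\<in>?S. (-2) ^ (2*i) * iter_integral ks 0)"
    by (rule sum.reindex_bij_witness[of _ rev rev]) (auto simp: Icomp_def)
  finally have W: "W (2*j + 2*i - 1) (2*i) = 2 ^ (2*i) * (\<Sum>ks\<in>?S. iter_integral ks 0)"
    by (simp add: sum_distrib_left)
  have "ennreal (\<Sum>ks\<in>?S. iter_integral ks 0) = (\<Sum>ks\<in>Icomp ((2*j - 1) + Suc (2*i - 1)) (Suc (2*i - 1)). ennreal (iter_integral ks 0))"
    using assms by (simp add: sum_ennreal iter_integral_nonneg)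
  also have "\<dots> = (\<integral>\<^sup>+w. ennreal (cut_monom (2*j - 1) (w - 0) * half_sech w * cut_monom (2*i - 1) (half_gd w - half_gd 0)) \<partial>lborel)"
    by (rule sum_Icomp_iter_integral) simp
  finally have S: "(\<integral>\<^sup>+w. ennreal (cut_monom (2*j - 1) w * half_sech w * cut_monom (2*i - 1) (half_gd w)) \<partial>lborel)
      = ennreal (\<Sum>ks\<in>?S. iter_integral ks 0)" by simp
  have "has_bochner_integral lborel (\<lambda>w. cut_monom (2*j - 1) w * half_sech w * cut_monom (2*i - 1) (half_gd w)) (\<Sum>ks\<in>?S. iter_integral ks 0)"
    by (rule has_bochner_integral_nn_integral[OF _ _ _ S]) (auto intro!: sum_nonneg iter_integral_nonneg)
  then have "has_bochner_integral lborel
     (\<lambda>w. 2 ^ (2*i) * (cut_monom (2*j - 1) w * half_sech w * cut_monom (2*i - 1) (half_gd w))) (W (2*j + 2*i - 1) (2*i))"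
    unfolding W by (rule has_bochner_integral_mult_right)
  moreover have "2 ^ (2*i) * (cut_monom (2*j - 1) w * half_sech w * cut_monom (2*i - 1) (half_gd w))
     = cut_monom (2*j - 1) w * (2 * half_sech w * ((2 * half_gd w) ^ (2*i - 1) / fact (2*i - 1)))" for w
  proof (cases "0 \<le> w")
    case True
    have "(2::real) ^ (2*i) = 2 * 2 ^ (2*i - 1)"
      using assms by (cases i) auto
    then show ?thesis using half_gd_nonneg[OF True] by (simp add: cut_monom_def power_mult_distrib)
  qed (simp add: cut_monom_def)
  ultimately show ?thesis by simp
qed

section \<open>The generating polynomials of the alternating zeta values\<close>

text \<open>The conjugate Poisson kernel of radius \<open>exp (- w)\<close> at the angle
  \<open>pi - \<phi>\<close>. For \<open>w > 0\<close> it is twice the sum of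
  \<open>(-1) ^ (n + 1) * exp (- (n * w)) * sin (n * \<phi>)\<close> over
  \<open>n \<ge> 1\<close>.\<close>

definition conj_poisson :: "real \<Rightarrow> real \<Rightarrow> real" where
  "conj_poisson \<phi> w = sin \<phi> / (cosh w + cos \<phi>)"

lemma conj_poisson_measurable [measurable]: "conj_poisson \<phi> \<in> borel_measurable borel"
  unfolding conj_poisson_def[abs_def] cosh_def by measurable

lemma one_le_conj_poisson_denom:
  fixes w \<phi> :: real
  assumes "0 \<le> cos \<phi>"
  shows "1 \<le> 1 + 2 * exp (- w) * cos \<phi> + (exp (- w))\<^sup>2"
  using assms by simp

lemma conj_poisson_altdef:
  "conj_poisson \<phi> w = 2 * exp (- w) * sin \<phi> / (1 + 2 * exp (- w) * cos \<phi> + (exp (- w))\<^sup>2)"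
proof -
  have "1 + 2 * exp (- w) * cos \<phi> + (exp (- w))\<^sup>2 = (2 * exp (- w)) * (cosh w + cos \<phi>)"
    by (simp add: cosh_def algebra_simps power2_eq_square flip: exp_add)
  then show ?thesis by (simp add: conj_poisson_def)
qed

text \<open>The factor \<open>1 + 2 * q * cos \<phi> + q\<^sup>2\<close> makes the sum telescope, by
  the recurrence \<open>sin ((n + 2) * \<phi>) + sin (n * \<phi>) = 2 * cos \<phi> * sin ((n + 1) *
  \<phi>)\<close>.\<close>

lemma alternating_sin_sum:
  fixes q \<phi> :: real
  shows "(\<Sum>n=1..N. (-1) ^ (n + 1) * (q ^ n * sin (real n * \<phi>))) * (1 + 2 * q * cos \<phi> + q\<^sup>2)
   = q * sin \<phi> + (-1) ^ (N + 1) * (q ^ (N + 1) * sin (real (N + 1) * \<phi>) + q ^ (N + 2) * sin (real N * \<phi>))"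
proof (induction N)
  case 0
  show ?case by simp
next
  case (Suc N)
  have "sin (real (N + 2) * \<phi>) + sin (real N * \<phi>) = 2 * cos \<phi> * sin (real (N + 1) * \<phi>)"
    using sin_plus_sin[of "real (N + 2) * \<phi>" "real N * \<phi>"] by (simp add: algebra_simps add_divide_distrib)
  then have s: "sin (real (Suc N + 1) * \<phi>) = 2 * cos \<phi> * sin (real (Suc N) * \<phi>) - sin (real N * \<phi>)"
    by (simp add: algebra_simps)
  show ?case
    using Suc unfolding s by (simp add: algebra_simps power2_eq_square)
qed

text \<open>For \<open>cos \<phi> \<ge> 0\<close> the denominator is at least 1, so the bound
  persists down to \<open>w = 0\<close>. The constant 4 is the outer factor 2 times the two boundary
  terms of the telescoped sum.\<close>

lemma conj_poisson_remainder:
  assumes "0 \<le> cos \<phi>" "0 \<le> w"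
  shows "\<bar>conj_poisson \<phi> w - 2 * (\<Sum>n=1..N. (-1) ^ (n + 1) * sin (real n * \<phi>) * exp (- (real n * w)))\<bar>
     \<le> 4 * exp (- (real (N + 1) * w))"
proof -
  define q where "q = exp (- w)"
  define D where "D = 1 + 2 * q * cos \<phi> + q\<^sup>2"
  define S where "S = (\<Sum>n=1..N. (-1) ^ (n + 1) * (q ^ n * sin (real n * \<phi>)))"
  define R where "R = q ^ (N + 1) * sin (real (N + 1) * \<phi>) + q ^ (N + 2) * sin (real N * \<phi>)"
  have D: "1 \<le> D" using one_le_conj_poisson_denom[OF assms(1), of w] by (simp add: D_def q_def)
  have q: "0 \<le> q" "q \<le> 1" using assms by (auto simp: q_def)
  have qn: "exp (- (real n * w)) = q ^ n" for n
    by (simp add: q_def flip: exp_of_nat_mult)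
  have "S * D = q * sin \<phi> + (-1) ^ (N + 1) * R"
    using alternating_sin_sum[where N = N and q = q and \<phi> = \<phi>] by (simp add: S_def D_def R_def)
  then have "2 * q * sin \<phi> / D - 2 * S = - (2 * (-1) ^ (N + 1) * R / D)"
    using D by (simp add: field_simps)
  then have "\<bar>2 * q * sin \<phi> / D - 2 * S\<bar> = 2 * \<bar>R\<bar> / D"
    using D by (simp add: abs_mult)
  also have "\<dots> \<le> 2 * \<bar>R\<bar> / 1"
    using D by (intro divide_left_mono) auto
  also have "\<bar>R\<bar> \<le> q ^ (N + 1) * 1 + q ^ (N + 1) * 1"
    unfolding R_def
  proof (rule order_trans[OF abs_triangle_ineq add_mono])
    show "\<bar>q ^ (N + 1) * sin (real (N + 1) * \<phi>)\<bar> \<le> q ^ (N + 1) * 1"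
      unfolding abs_mult using q by (intro mult_mono) (auto simp: power_abs)
    have "q ^ (N + 2) \<le> q ^ (N + 1)" using q by (intro power_decreasing) auto
    then show "\<bar>q ^ (N + 2) * sin (real N * \<phi>)\<bar> \<le> q ^ (N + 1) * 1"
      unfolding abs_mult using q by (intro mult_mono) (auto simp: power_abs)
  qed
  finally have "\<bar>2 * q * sin \<phi> / D - 2 * S\<bar> \<le> 4 * q ^ (N + 1)" by simp
  moreover have "conj_poisson \<phi> w = 2 * q * sin \<phi> / D"
    by (simp add: conj_poisson_altdef D_def q_def)
  moreover have "(\<Sum>n=1..N. (-1) ^ (n + 1) * sin (real n * \<phi>) * exp (- (real n * w))) = S"
    unfolding S_def qn by (simp add: mult_ac)
  ultimately show ?thesis using qn[of "N + 1"] by simp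
qed

lemma conj_poisson_nonneg:
  assumes "0 \<le> cos \<phi>" "0 \<le> sin \<phi>"
  shows "0 \<le> conj_poisson \<phi> w"
  using assms by (simp add: conj_poisson_def add_nonneg_nonneg)

text \<open>The remainder bound with an empty sum, \<open>N = 0\<close>, is the majorant
  \<open>4 * exp (- w)\<close>.\<close>

lemma integrable_cut_monom_conj_poisson:
  assumes "0 \<le> cos \<phi>"
  shows "integrable lborel (\<lambda>w. cut_monom k w * conj_poisson \<phi> w)"
  using integrable_cut_monom_bounded[of "conj_poisson \<phi>" 1 0 4 k] conj_poisson_remainder[OF assms, of _ 0] by simp

lemma integral_cut_monom_conj_poisson_series:
  assumes "0 \<le> cos \<phi>"
  shows "\<bar>(\<integral>w. cut_monom k w * conj_poisson \<phi> w \<partial>lborel) - 2 * (\<Sum>n=1..N. (-1) ^ (n + 1) * sin (real n * \<phi>) / real n ^ Suc k)\<bar>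
    \<le> 4 / real (N + 1)"
proof -
  let ?S = "\<lambda>w. 2 * (\<Sum>n=1..N. (-1) ^ (n + 1) * sin (real n * \<phi>) * exp (- (real n * w)))"
  let ?c = "\<lambda>n. (-1) ^ (n + 1) * sin (real n * \<phi>)"
  have "has_bochner_integral lborel (\<lambda>w. 2 * (\<Sum>n=1..N. ?c n * (cut_monom k (w - 0) * exp (- (real n * w)))))
     (2 * (\<Sum>n=1..N. ?c n * (exp (- (real n * 0)) / real n ^ Suc k)))"
    by (intro has_bochner_integral_mult_right has_bochner_integral_sum has_bochner_integral_cut_monom_exp) auto
  then have S: "has_bochner_integral lborel (\<lambda>w. cut_monom k w * ?S w) (2 * (\<Sum>n=1..N. ?c n / real n ^ Suc k))"
    by (simp add: sum_distrib_left mult_ac)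
  have "(\<integral>w. cut_monom k w * conj_poisson \<phi> w \<partial>lborel) - 2 * (\<Sum>n=1..N. ?c n / real n ^ Suc k)
      = (\<integral>w. cut_monom k w * conj_poisson \<phi> w - cut_monom k w * ?S w \<partial>lborel)"
    using S integrable_cut_monom_conj_poisson[OF assms]
    by (subst Bochner_Integration.integral_diff)
       (auto simp: has_bochner_integral_iff simp del: sum_distrib_left)
  also have "\<dots> = (\<integral>w. cut_monom k (w - 0) * (conj_poisson \<phi> w - ?S w) \<partial>lborel)"
    by (simp add: algebra_simps)
  also have "\<bar>\<dots>\<bar> \<le> 4 * (exp (- (real (N + 1) * 0)) / real (N + 1) ^ Suc k)"
    by (rule integral_cut_monom_bounded, measurable) (use conj_poisson_remainder[OF assms] in auto)
  also have "\<dots> \<le> 4 / real (N + 1)"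
    using power_increasing[of 1 "Suc k" "real (N + 1)"] by (auto intro!: divide_left_mono)
  finally show ?thesis .
qed

text \<open>The antiderivative \<open>F\<close> is -2 times the argument of the complex number
  \<open>1 + exp (- w) * cis \<phi>\<close>. That argument falls from \<open>\<phi> / 2\<close> at
  \<open>w = 0\<close> to 0 at infinity.\<close>

lemma integral_conj_poisson:
  assumes "0 \<le> \<phi>" "\<phi> \<le> pi / 2"
  shows "(\<integral>w. cut_monom 0 w * conj_poisson \<phi> w \<partial>lborel) = \<phi>"
proof -
  have c: "0 \<le> cos \<phi>" and s: "0 \<le> sin \<phi>"
    using assms by (auto intro!: cos_ge_zero sin_ge_zero)
  define F where "F w = - 2 * arctan (exp (- w) * sin \<phi> / (1 + exp (- w) * cos \<phi>))" for w
  have "(\<integral>\<^sup>+w. ennreal (conj_poisson \<phi> w) * indicator {0..} w \<partial>lborel) = ennreal (0 - F 0)"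
  proof (rule nn_integral_FTC_atLeast)
    fix w :: real
    define q where "q = exp (- w)"
    have q: "0 < 1 + q * cos \<phi>" using c by (simp add: q_def add_pos_nonneg)
    have id: "(1 + q * cos \<phi>)\<^sup>2 + (q * sin \<phi>)\<^sup>2 = 1 + 2 * q * cos \<phi> + q\<^sup>2"
      using sin_cos_squared_add[of \<phi>] by algebra
    have "(F has_real_derivative - 2 * (inverse (1 + (q * sin \<phi> / (1 + q * cos \<phi>))\<^sup>2) *
        ((- q * sin \<phi> * (1 + q * cos \<phi>) - q * sin \<phi> * (- q * cos \<phi>)) / (1 + q * cos \<phi>)\<^sup>2))) (at w)"
      unfolding F_def[abs_def] q_def
      by (rule derivative_eq_intros refl | use q in \<open>simp add: q_def power2_eq_square\<close>)+
    also have "- 2 * (inverse (1 + (q * sin \<phi> / (1 + q * cos \<phi>))\<^sup>2) *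
        ((- q * sin \<phi> * (1 + q * cos \<phi>) - q * sin \<phi> * (- q * cos \<phi>)) / (1 + q * cos \<phi>)\<^sup>2))
      = 2 * q * sin \<phi> / ((1 + q * cos \<phi>)\<^sup>2 + (q * sin \<phi>)\<^sup>2)"
    proof -
      have "inverse (1 + (q * sin \<phi> / (1 + q * cos \<phi>))\<^sup>2)
          = (1 + q * cos \<phi>)\<^sup>2 / ((1 + q * cos \<phi>)\<^sup>2 + (q * sin \<phi>)\<^sup>2)"
        using q by (simp add: power_divide add_divide_eq_iff)
      moreover have "- q * sin \<phi> * (1 + q * cos \<phi>) - q * sin \<phi> * (- q * cos \<phi>) = - (q * sin \<phi>)"
        by (simp add: algebra_simps)
      ultimately show ?thesis using q by simp
    qed
    finally show "(F has_real_derivative conj_poisson \<phi> w) (at w)"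
      unfolding id by (simp add: conj_poisson_altdef q_def)
  next
    have "((\<lambda>w::real. exp (- w)) \<longlongrightarrow> 0) at_top" by real_asymp
    then have "(F \<longlongrightarrow> - 2 * arctan (0 * sin \<phi> / (1 + 0 * cos \<phi>))) at_top"
      unfolding F_def[abs_def] by (intro tendsto_intros) auto
    then show "(F \<longlongrightarrow> 0) at_top" by simp
  qed (use c s in \<open>auto intro: conj_poisson_nonneg\<close>)
  also have "0 - F 0 = \<phi>"
  proof -
    have "sin \<phi> / (1 + cos \<phi>) = tan (\<phi> / 2)"
      using tan_half[of "\<phi> / 2"] by (simp add: add.commute)
    moreover have "arctan (tan (\<phi> / 2)) = \<phi> / 2"
      using assms pi_gt_zero by (intro arctan_tan; linarith)
    ultimately show ?thesis by (simp add: F_def)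
  qed
  finally have "(\<integral>\<^sup>+w. ennreal (conj_poisson \<phi> w) * indicator {0..} w \<partial>lborel) = ennreal \<phi>" .
  moreover have "(\<integral>\<^sup>+w. ennreal (cut_monom 0 w * conj_poisson \<phi> w) \<partial>lborel)
      = (\<integral>\<^sup>+w. ennreal (conj_poisson \<phi> w) * indicator {0..} w \<partial>lborel)"
    by (intro nn_integral_cong) (auto simp: cut_monom_def indicator_def)
  ultimately have "(\<integral>\<^sup>+w. ennreal (cut_monom 0 w * conj_poisson \<phi> w) \<partial>lborel) = ennreal \<phi>" by simp
  then show ?thesis
    using assms c s
    by (intro has_bochner_integral_integral_eq has_bochner_integral_nn_integral)
       (auto intro!: AE_I2 conj_poisson_nonneg mult_nonneg_nonneg)
qed

section \<open>Sine series with alternating zeta values as Taylor coefficients\<close>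

lemma zetabar_limit:
  assumes "2 \<le> s"
  shows "(\<lambda>N. \<Sum>n=1..N. (-1) ^ (n + 1) / real n ^ s) \<longlonglongrightarrow> zetabar s"
proof -
  have "summable (\<lambda>n. inverse (real (Suc n) ^ s))"
    using inverse_power_summable[OF assms, where 'a = real] by (subst summable_Suc_iff)
  then have "summable (\<lambda>n. (-1) ^ n / real (n + 1) ^ s)"
    by (intro summable_norm_cancel[of "\<lambda>n. (-1) ^ n / real (n + 1) ^ s"])
       (simp add: norm_divide norm_power inverse_eq_divide)
  then have "(\<lambda>N. \<Sum>n<N. (-1) ^ n / real (n + 1) ^ s) \<longlonglongrightarrow> zetabar s"
    using assms by (simp add: zetabar_def summable_LIMSEQ)
  moreover have "(\<Sum>n<N. (-1) ^ n / real (n + 1) ^ s) = (\<Sum>n=1..N. (-1) ^ (n + 1) / real n ^ s)" for N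
    by (induction N) auto
  ultimately show ?thesis by simp
qed

lemma deriv_bound_from_0:
  fixes f :: "real \<Rightarrow> real"
  assumes "\<And>x. (f has_real_derivative f' x) (at x)" "0 \<le> x"
    and "\<And>t. \<lbrakk>0 \<le> t; t \<le> x\<rbrakk> \<Longrightarrow> \<bar>f' t\<bar> \<le> B"
  shows "\<bar>f x\<bar> \<le> \<bar>f 0\<bar> + B * x"
proof (cases "x = 0")
  case False
  then obtain t where "0 < t" "t < x" "f x - f 0 = (x - 0) * f' t"
    using MVT2[of 0 x f f'] assms by auto
  moreover from this have "\<bar>x * f' t\<bar> \<le> x * B"
    using assms(2) assms(3)[of t] by (simp add: abs_mult mult_left_mono)
  ultimately show ?thesis by (simp add: mult.commute)
qed (use assms(3)[of 0] in auto)

text \<open>On \<open>[0, pi/2]\<close> this is twice the sum of the sine series with terms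
  \<open>(-1) ^ (n + 1) * sin (n * \<phi>) / n ^ (2*m - 1)\<close>; its odd derivatives at 0 are
  alternating zeta values up to a factor 2 and sign.\<close>

definition zpoly :: "nat \<Rightarrow> real \<Rightarrow> real" where
  "zpoly m \<phi> = (\<Sum>i=1..m. 2 * zetabar (2*m - 2*i) * ((-1) ^ (i - 1) * (\<phi> ^ (2*i - 1) / fact (2*i - 1))))"

definition zpoly' :: "nat \<Rightarrow> real \<Rightarrow> real" where
  "zpoly' m \<phi> = (\<Sum>i=1..m. 2 * zetabar (2*m - 2*i) * ((-1) ^ (i - 1) * (\<phi> ^ (2*i - 2) / fact (2*i - 2))))"

lemma zpoly_deriv: "(zpoly m has_real_derivative zpoly' m \<phi>) (at \<phi>)"
  unfolding zpoly_def[abs_def] zpoly'_def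
proof (intro DERIV_sum DERIV_cmult)
  fix i assume i: "i \<in> {1..m}"
  then obtain k where k: "2*i - 1 = Suc k" "2*i - 2 = k"
    by (cases i) auto
  show "((\<lambda>\<phi>. \<phi> ^ (2*i - 1) / fact (2*i - 1)) has_real_derivative \<phi> ^ (2*i - 2) / fact (2*i - 2)) (at \<phi>)"
    unfolding k by (rule derivative_eq_intros refl | simp)+
qed

text \<open>Together with \<open>zpoly_deriv\<close> this gives the relation that the sine series
  satisfy as well: two derivatives lower \<open>m\<close> by one and change the sign.\<close>

lemma zpoly'_deriv: "(zpoly' (Suc m) has_real_derivative - zpoly m \<phi>) (at \<phi>)"
proof -
  \<comment> \<open>The term \<open>i = 1\<close> is constant; splitting it off leaves only positive
    powers to differentiate.\<close>
  have eq: "zpoly' (Suc m) \<phi> = 2 * zetabar (2 * m) +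
      (\<Sum>i=1..m. 2 * zetabar (2*m - 2*i) * ((-1) ^ i * (\<phi> ^ (2*i) / fact (2*i))))" for \<phi>
    unfolding zpoly'_def
    by (subst sum.atLeast_Suc_atMost)
       (auto simp: sum.shift_bounds_cl_Suc_ivl simp del: sum.cl_ivl_Suc)
  have "((\<lambda>\<phi>. 2 * zetabar (2 * m) +
      (\<Sum>i=1..m. 2 * zetabar (2*m - 2*i) * ((-1) ^ i * (\<phi> ^ (2*i) / fact (2*i))))) has_real_derivative
      0 + (\<Sum>i=1..m. 2 * zetabar (2*m - 2*i) * ((-1) ^ i * (\<phi> ^ (2*i - 1) / fact (2*i - 1))))) (at \<phi>)"
  proof (intro DERIV_add DERIV_sum DERIV_cmult DERIV_const)
    fix i assume i: "i \<in> {1..m}"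
    then obtain k where k: "2*i = Suc k" "2*i - 1 = k"
      by (cases i) auto
    show "((\<lambda>\<phi>. \<phi> ^ (2*i) / fact (2*i)) has_real_derivative \<phi> ^ (2*i - 1) / fact (2*i - 1)) (at \<phi>)"
      unfolding k by (rule derivative_eq_intros refl | simp)+
  qed
  moreover have "(\<Sum>i=1..m. 2 * zetabar (2*m - 2*i) * ((-1) ^ i * (\<phi> ^ (2*i - 1) / fact (2*i - 1)))) = - zpoly m \<phi>"
    unfolding zpoly_def sum_negf[symmetric]
  proof (rule sum.cong[OF refl])
    fix i assume "i \<in> {1..m}"
    then obtain k where "i = Suc k" by (cases i) auto
    then show "2 * zetabar (2*m - 2*i) * ((-1) ^ i * (\<phi> ^ (2*i - 1) / fact (2*i - 1)))
      = - (2 * zetabar (2*m - 2*i) * ((-1) ^ (i - 1) * (\<phi> ^ (2*i - 1) / fact (2*i - 1))))" by simp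
  qed
  ultimately show ?thesis unfolding eq[abs_def] by simp
qed

text \<open>Induction on \<open>m\<close>, integrating twice from 0. The base case is the integral
  of the conjugate Poisson kernel. In the step, series and polynomial both vanish at 0, and their
  first derivatives there agree in the limit because of \<open>zetabar (2*m)\<close>. Uniform bounds
  for finite sums avoid differentiating an infinite series.\<close>

lemma zpoly_series:
  assumes "1 \<le> m"
  shows "\<exists>\<epsilon>. \<epsilon> \<longlonglongrightarrow> 0 \<and> (\<forall>N. \<forall>\<phi>\<in>{0..pi/2}.
     \<bar>2 * (\<Sum>n=1..N. (-1) ^ (n + 1) * sin (real n * \<phi>) / real n ^ (2*m - 1)) - zpoly m \<phi>\<bar> \<le> \<epsilon> N)"
  using assms
proof (induction m rule: dec_induct)
  case base
  have "\<bar>2 * (\<Sum>n=1..N. (-1) ^ (n + 1) * sin (real n * \<phi>) / real n ^ (2*1 - 1)) - zpoly 1 \<phi>\<bar> \<le> 4 / real (N + 1)"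
    if "\<phi> \<in> {0..pi/2}" for N \<phi>
    using integral_cut_monom_conj_poisson_series[of \<phi> 0 N] integral_conj_poisson[of \<phi>] that cos_ge_zero[of \<phi>]
    by (simp add: zpoly_def zetabar_def abs_minus_commute)
  moreover have "(\<lambda>N. 4 / real (N + 1)) \<longlonglongrightarrow> 0" by real_asymp
  ultimately show ?case by blast
next
  case (step m)
  then obtain \<epsilon> where \<epsilon>: "\<epsilon> \<longlonglongrightarrow> 0" and bd: "\<And>N \<phi>. \<phi> \<in> {0..pi/2} \<Longrightarrow>
     \<bar>2 * (\<Sum>n=1..N. (-1) ^ (n + 1) * sin (real n * \<phi>) / real n ^ (2*m - 1)) - zpoly m \<phi>\<bar> \<le> \<epsilon> N"
    by auto
  define \<delta> where "\<delta> N = \<bar>2 * (\<Sum>n=1..N. (-1) ^ (n + 1) / real n ^ (2*m)) - 2 * zetabar (2*m)\<bar>" for N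
  have \<delta>: "\<delta> \<longlonglongrightarrow> 0"
  proof -
    have "\<delta> \<longlonglongrightarrow> \<bar>2 * zetabar (2*m) - 2 * zetabar (2*m)\<bar>"
      unfolding \<delta>_def[abs_def] using step by (intro tendsto_intros zetabar_limit) auto
    then show ?thesis by simp
  qed
  \<comment> \<open>\<open>\<delta> N\<close> is the error of the first derivative at 0 and
    \<open>\<epsilon> N\<close> bounds the second derivative; each factor 2 comes from a mean value
    estimate on an interval of length at most \<open>pi / 2 \<le> 2\<close>.\<close>
  have "\<bar>2 * (\<Sum>n=1..N. (-1) ^ (n + 1) * sin (real n * \<phi>) / real n ^ (2 * Suc m - 1)) - zpoly (Suc m) \<phi>\<bar>
      \<le> (\<delta> N + \<epsilon> N * 2) * 2" if \<phi>: "\<phi> \<in> {0..pi/2}" for N \<phi>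
  proof -
    define g where "g \<phi> = 2 * (\<Sum>n=1..N. (-1) ^ (n + 1) * (sin (real n * \<phi>) / real n ^ (2*m + 1))) - zpoly (Suc m) \<phi>" for \<phi>
    define g' where "g' \<phi> = 2 * (\<Sum>n=1..N. (-1) ^ (n + 1) * (cos (real n * \<phi>) / real n ^ (2*m))) - zpoly' (Suc m) \<phi>" for \<phi>
    define g'' where "g'' \<phi> = 2 * (\<Sum>n=1..N. (-1) ^ (n + 1) * (- sin (real n * \<phi>) / real n ^ (2*m - 1))) - (- zpoly m \<phi>)" for \<phi>
    have g: "(g has_real_derivative g' t) (at t)" for t
      unfolding g_def[abs_def] g'_def
    proof (intro DERIV_diff DERIV_cmult DERIV_sum zpoly_deriv)
      fix n assume "n \<in> {1..N}"
      then show "((\<lambda>\<phi>. sin (real n * \<phi>) / real n ^ (2*m + 1)) has_real_derivative cos (real n * t) / real n ^ (2*m)) (at t)"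
        by (auto intro!: derivative_eq_intros simp: field_simps)
    qed
    have g': "(g' has_real_derivative g'' t) (at t)" for t
      unfolding g'_def[abs_def] g''_def
    proof (intro DERIV_diff DERIV_cmult DERIV_sum zpoly'_deriv)
      fix n assume n: "n \<in> {1..N}"
      obtain k where k: "2 * m = Suc k" "2 * m - 1 = k" using step by (cases m) auto
      show "((\<lambda>\<phi>. cos (real n * \<phi>) / real n ^ (2*m)) has_real_derivative - sin (real n * t) / real n ^ (2*m - 1)) (at t)"
        unfolding k using n by (auto intro!: derivative_eq_intros simp: field_simps)
    qed
    have g'': "\<bar>g'' t\<bar> \<le> \<epsilon> N" if "t \<in> {0..pi/2}" for t
      using bd[OF that, of N] by (simp add: g''_def sum_negf abs_minus_commute)
    have g'0: "\<bar>g' 0\<bar> = \<delta> N"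
    proof -
      have "zpoly' (Suc m) 0 = 2 * zetabar (2*m)"
        unfolding zpoly'_def
        by (subst sum.atLeast_Suc_atMost) (auto simp: zero_power intro!: sum.neutral)
      then show ?thesis by (simp add: g'_def \<delta>_def)
    qed
    have \<epsilon>0: "0 \<le> \<epsilon> N" using bd[of 0 N] by auto
    have pi2: "pi / 2 \<le> 2" using pi_less_4 by simp
    have g'bd: "\<bar>g' t\<bar> \<le> \<delta> N + \<epsilon> N * 2" if "t \<in> {0..pi/2}" for t
    proof -
      have "\<bar>g' t\<bar> \<le> \<bar>g' 0\<bar> + \<epsilon> N * t"
        by (rule deriv_bound_from_0[OF g']) (use that g'' in auto)
      also have "\<epsilon> N * t \<le> \<epsilon> N * 2" using that pi2 \<epsilon>0 by (intro mult_left_mono) auto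
      finally show ?thesis using g'0 by simp
    qed
    have "\<bar>g \<phi>\<bar> \<le> \<bar>g 0\<bar> + (\<delta> N + \<epsilon> N * 2) * \<phi>"
      by (rule deriv_bound_from_0[OF g]) (use \<phi> g'bd in auto)
    also have "g 0 = 0"
      by (auto simp: g_def zpoly_def intro!: sum.neutral)
    also have "(\<delta> N + \<epsilon> N * 2) * \<phi> \<le> (\<delta> N + \<epsilon> N * 2) * 2"
      using \<phi> pi2 \<epsilon>0 by (intro mult_left_mono) (auto simp: \<delta>_def)
    finally show ?thesis by (simp add: g_def)
  qed
  moreover have "(\<lambda>N. (\<delta> N + \<epsilon> N * 2) * 2) \<longlonglongrightarrow> (0 + 0 * 2) * 2"
    by (intro tendsto_intros \<epsilon> \<delta>)
  ultimately show ?case by (intro exI[of _ "\<lambda>N. (\<delta> N + \<epsilon> N * 2) * 2"]) auto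
qed

text \<open>Both sides are limits of the same truncated sine series.\<close>

lemma zpoly_eq_integral:
  assumes "1 \<le> m" "0 \<le> \<phi>" "\<phi> \<le> pi / 2"
  shows "zpoly m \<phi> = (\<integral>w. cut_monom (2*m - 2) w * conj_poisson \<phi> w \<partial>lborel)"
proof -
  let ?T = "\<lambda>N. 2 * (\<Sum>n=1..N. (-1) ^ (n + 1) * sin (real n * \<phi>) / real n ^ (2*m - 1))"
  let ?I = "\<integral>w. cut_monom (2*m - 2) w * conj_poisson \<phi> w \<partial>lborel"
  obtain \<epsilon> where \<epsilon>: "\<epsilon> \<longlonglongrightarrow> 0" and bd: "\<And>N. \<bar>?T N - zpoly m \<phi>\<bar> \<le> \<epsilon> N"
    using zpoly_series[OF assms(1)] assms(2,3) by auto
  have "(\<lambda>N. ?T N - zpoly m \<phi>) \<longlonglongrightarrow> 0"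
    using bd by (intro Lim_null_comparison[OF _ \<epsilon>] always_eventually) auto
  then have "?T \<longlonglongrightarrow> zpoly m \<phi>" by (simp only: LIM_zero_iff)
  moreover have "\<bar>?T N - ?I\<bar> \<le> 4 / real (N + 1)" for N
  proof -
    have eq: "Suc (2*m - 2) = 2*m - 1" using assms(1) by simp
    have "0 \<le> cos \<phi>" using assms by (intro cos_ge_zero) auto
    from integral_cut_monom_conj_poisson_series[OF this, of "2*m - 2" N, unfolded eq] show ?thesis
      by (subst abs_minus_commute)
  qed
  then have ev: "\<forall>\<^sub>F N in sequentially. norm (?T N - ?I) \<le> 4 / real (N + 1)"
    by (intro always_eventually allI) (simp only: real_norm_def)
  have "(\<lambda>N. 4 / real (N + 1)) \<longlonglongrightarrow> 0" by real_asymp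
  with ev have "(\<lambda>N. ?T N - ?I) \<longlonglongrightarrow> 0" by (rule Lim_null_comparison)
  then have "?T \<longlonglongrightarrow> ?I" by (simp only: LIM_zero_iff)
  ultimately show ?thesis by (rule LIMSEQ_unique)
qed

section \<open>The symmetric double integral\<close>

lemma nn_integral_cut_monom_atMost:
  "(\<integral>\<^sup>+w. ennreal (cut_monom k w) * indicator {..z} w \<partial>lborel) = ennreal (cut_monom (Suc k) z)"
proof (cases "0 \<le> z")
  case True
  have "(\<integral>\<^sup>+w. ennreal (cut_monom k w) * indicator {..z} w \<partial>lborel)
      = (\<integral>\<^sup>+w. ennreal (cut_monom k w) * indicator {0..z} w \<partial>lborel)"
    by (intro nn_integral_cong) (auto simp: cut_monom_def indicator_def)
  also have "\<dots> = (\<integral>\<^sup>+w. ennreal (w ^ k / fact k) * indicator {0..z} w \<partial>lborel)"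
    by (intro nn_integral_cong) (auto simp: cut_monom_def indicator_def)
  also have "\<dots> = ennreal (z ^ Suc k / fact (Suc k) - 0 ^ Suc k / fact (Suc k))"
  proof (rule nn_integral_FTC_Icc)
    fix x :: real
    show "((\<lambda>x. x ^ Suc k / fact (Suc k)) has_real_derivative x ^ k / fact k) (at x)"
      by (rule derivative_eq_intros refl | simp)+
  qed (use True in auto)
  finally show ?thesis using True by (simp add: cut_monom_def)
next
  case False
  then have "(\<integral>\<^sup>+w. ennreal (cut_monom k w) * indicator {..z} w \<partial>lborel) = (\<integral>\<^sup>+w. 0 \<partial>(lborel :: real measure))"
    by (intro nn_integral_cong) (auto simp: cut_monom_def indicator_def)
  then show ?thesis using False by (simp add: cut_monom_def)
qed

lemma one_plus_cosh_pos:
  fixes c w :: real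
  assumes "0 < c"
  shows "0 < 1 + c * cosh w"
  using assms cosh_real_pos[of w] by (intro add_pos_pos mult_pos_pos) auto

lemma nn_integral_sinh_tail:
  assumes "0 < c" "0 \<le> w"
  shows "(\<integral>\<^sup>+z. ennreal (c * sinh z / (1 + c * cosh z)\<^sup>2) * indicator {w..} z \<partial>lborel)
     = ennreal (1 / (1 + c * cosh w))"
proof -
  have "(\<integral>\<^sup>+z. ennreal (c * sinh z / (1 + c * cosh z)\<^sup>2) * indicator {w..} z \<partial>lborel)
     = ennreal (0 - (- (1 / (1 + c * cosh w))))"
  proof (rule nn_integral_FTC_atLeast)
    fix z :: real
    have "1 + c * cosh z \<noteq> 0" using one_plus_cosh_pos[OF assms(1), of z] by simp
    then show "((\<lambda>z. - (1 / (1 + c * cosh z))) has_real_derivative c * sinh z / (1 + c * cosh z)\<^sup>2) (at z)"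
      by (auto intro!: derivative_eq_intros simp: power2_eq_square)
    assume "w \<le> z"
    then show "0 \<le> c * sinh z / (1 + c * cosh z)\<^sup>2" using assms by simp
  next
    show "((\<lambda>z. - (1 / (1 + c * cosh z))) \<longlongrightarrow> 0) at_top"
      using assms(1) unfolding cosh_field_def by real_asymp
  next
    show "(\<lambda>z. c * sinh z / (1 + c * cosh z)\<^sup>2) \<in> borel_measurable borel"
      unfolding sinh_def cosh_def by measurable
  qed
  then show ?thesis by simp
qed

text \<open>Integration by parts done with Tonelli, hence without boundary terms:
  \<open>1 / (1 + c * cosh w)\<close> is the integral over \<open>z \<ge> w\<close> of its negated
  derivative, and the \<open>w\<close>-integral of \<open>cut_monom k\<close> up to \<open>z\<close>
  raises the degree by one.\<close>

lemma nn_integral_cut_monom_by_parts: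
  assumes "0 < c"
  shows "(\<integral>\<^sup>+w. ennreal (cut_monom k w * (1 / (1 + c * cosh w))) \<partial>lborel)
     = (\<integral>\<^sup>+z. ennreal (cut_monom (Suc k) z * (c * sinh z / (1 + c * cosh z)\<^sup>2)) \<partial>lborel)"
proof -
  let ?g = "\<lambda>z. c * sinh z / (1 + c * cosh z)\<^sup>2"
  have [measurable]: "?g \<in> borel_measurable borel"
    unfolding sinh_def cosh_def by measurable
  have "(\<integral>\<^sup>+w. ennreal (cut_monom k w * (1 / (1 + c * cosh w))) \<partial>lborel)
      = (\<integral>\<^sup>+w. ennreal (cut_monom k w) * (\<integral>\<^sup>+z. ennreal (?g z) * indicator {w..} z \<partial>lborel) \<partial>lborel)"
  proof (intro nn_integral_cong)
    fix w
    show "ennreal (cut_monom k w * (1 / (1 + c * cosh w)))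
      = ennreal (cut_monom k w) * (\<integral>\<^sup>+z. ennreal (?g z) * indicator {w..} z \<partial>lborel)"
    proof (cases "0 \<le> w")
      case True
      show ?thesis
        unfolding nn_integral_sinh_tail[OF assms True]
        by (simp only: ennreal_mult' cut_monom_nonneg)
    qed (simp add: cut_monom_def)
  qed
  also have "\<dots> = (\<integral>\<^sup>+w. \<integral>\<^sup>+z. ennreal (?g z) * (if w \<le> z then ennreal (cut_monom k w) else 0) \<partial>lborel \<partial>lborel)"
    by (subst nn_integral_cmult[symmetric]) (auto intro!: nn_integral_cong simp: indicator_def mult_ac)
  also have "\<dots> = (\<integral>\<^sup>+z. \<integral>\<^sup>+w. ennreal (?g z) * (if w \<le> z then ennreal (cut_monom k w) else 0) \<partial>lborel \<partial>lborel)"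
    by (rule lborel_pair.Fubini') measurable
  also have "\<dots> = (\<integral>\<^sup>+z. ennreal (?g z) * (\<integral>\<^sup>+w. ennreal (cut_monom k w) * indicator {..z} w \<partial>lborel) \<partial>lborel)"
    by (subst nn_integral_cmult[symmetric]) (auto intro!: nn_integral_cong simp: indicator_def)
  also have "\<dots> = (\<integral>\<^sup>+z. ennreal (cut_monom (Suc k) z * ?g z) \<partial>lborel)"
    unfolding nn_integral_cut_monom_atMost by (intro nn_integral_cong, subst mult.commute) (simp only: ennreal_mult' cut_monom_nonneg)
  finally show ?thesis .
qed

section \<open>The Gudermannian substitution and the symmetric kernel\<close>

lemma half_sech_eq_cosh: "2 * half_sech v = 1 / cosh v"
proof -
  have "cosh v * (2 * exp (- v)) = 1 + exp (- (2 * v))"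
    by (simp add: cosh_def algebra_simps flip: exp_add)
  moreover have "1 + exp (- (2 * v)) \<noteq> 0" by (metis add_pos_pos exp_gt_zero less_irrefl zero_less_one)
  ultimately show ?thesis using cosh_real_pos[of v] by (simp add: half_sech_def field_simps)
qed

text \<open>With \<open>q = exp (- v)\<close>, the angle is \<open>pi / 2 - 2 * arctan q\<close>, so
  the double-angle formulas give rational functions of \<open>q\<close>.\<close>

lemma
  shows sin_half_gd: "sin (2 * half_gd v) = tanh v" and cos_half_gd: "cos (2 * half_gd v) = 1 / cosh v"
proof -
  define q where "q = exp (- v)"
  have q: "1 + q\<^sup>2 > 0" by (simp add: add_pos_nonneg)
  have g: "2 * half_gd v = pi / 2 - 2 * arctan q" by (simp add: half_gd_def q_def)
  have q2: "q\<^sup>2 = exp (- (2 * v))" by (simp add: q_def power2_eq_square flip: exp_add)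
  have "sin (2 * half_gd v) = cos (2 * arctan q)"
    unfolding g by (simp add: sin_diff)
  also have "\<dots> = 2 * (cos (arctan q))\<^sup>2 - 1" by (rule cos_double_cos)
  also have "\<dots> = (1 - q\<^sup>2) / (1 + q\<^sup>2)"
    using q by (simp add: cos_arctan power_divide field_simps)
  also have "\<dots> = tanh v"
    unfolding q2 using tanh_real_altdef[of v] by (simp add: mult.commute)
  finally show "sin (2 * half_gd v) = tanh v" .
  have "cos (2 * half_gd v) = sin (2 * arctan q)"
    unfolding g by (simp add: cos_diff)
  also have "\<dots> = 2 * (q / (1 + q\<^sup>2))"
    unfolding sin_double using q by (simp add: sin_arctan cos_arctan)
  also have "\<dots> = 2 * half_sech v" unfolding q2 by (simp add: half_sech_def q_def)
  finally show "cos (2 * half_gd v) = 1 / cosh v" unfolding half_sech_eq_cosh .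
qed

text \<open>Clearing \<open>1 / cosh v\<close> from the denominator
  \<open>cosh w + 1 / cosh v\<close> makes it symmetric in \<open>v\<close> and \<open>w\<close>;
  only the factor \<open>tanh v\<close> still breaks the symmetry.\<close>

lemma half_sech_conj_poisson: "2 * half_sech v * conj_poisson (2 * half_gd v) w = tanh v * (1 / (1 + cosh v * cosh w))"
proof -
  have "0 < cosh v" "0 < 1 + cosh v * cosh w" 
    using one_plus_cosh_pos[of "cosh v" w] by (auto simp: cosh_real_pos)
  moreover from this have "cosh w + 1 / cosh v = (1 + cosh v * cosh w) / cosh v"
    by (simp add: field_simps)
  ultimately show ?thesis
    unfolding conj_poisson_def half_sech_eq_cosh sin_half_gd cos_half_gd by simp
qed

definition sym_kernel :: "real \<Rightarrow> real \<Rightarrow> real" where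
  "sym_kernel v z = sinh v * sinh z / (1 + cosh v * cosh z)\<^sup>2"

lemma sym_kernel_measurable [measurable]: "(\<lambda>(v, z). sym_kernel v z) \<in> borel_measurable (borel \<Otimes>\<^sub>M borel)"
  unfolding sym_kernel_def[abs_def] sinh_def cosh_def by measurable

text \<open>For \<open>v \<ge> 0\<close> the angle \<open>2 * half_gd v\<close> lies in
  \<open>[0, pi/2]\<close>, so the integral formula for \<open>zpoly\<close> applies. Integration by
  parts with \<open>c = cosh v\<close> then brings in \<open>cosh v * sinh z\<close>, and
  \<open>tanh v * cosh v = sinh v\<close> completes the kernel.\<close>

lemma
  assumes "1 \<le> m" "0 \<le> v"
  shows zpoly_half_gd_nonneg: "0 \<le> zpoly m (2 * half_gd v)"
    and zpoly_half_gd_eq: "ennreal (2 * half_sech v * zpoly m (2 * half_gd v)) = (\<integral>\<^sup>+z. ennreal (cut_monom (2*m - 1) z * sym_kernel v z) \<partial>lborel)"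
proof -
  have g: "0 \<le> 2 * half_gd v" "2 * half_gd v \<le> pi / 2"
    using half_gd_nonneg[OF assms(2)] half_gd_less[of v] by auto
  have c: "0 \<le> cos (2 * half_gd v)" and s: "0 \<le> sin (2 * half_gd v)"
    using assms by (simp_all add: sin_half_gd cos_half_gd)
  note z = zpoly_eq_integral[OF assms(1) g]
  show "0 \<le> zpoly m (2 * half_gd v)"
    unfolding z using conj_poisson_nonneg[OF c s] by (intro Bochner_Integration.integral_nonneg) auto
  have th: "0 \<le> tanh v" using assms by simp
  have "ennreal (2 * half_sech v * zpoly m (2 * half_gd v))
      = ennreal (\<integral>w. 2 * half_sech v * (cut_monom (2*m - 2) w * conj_poisson (2 * half_gd v) w) \<partial>lborel)"
    unfolding z by simp
  also have "\<dots> = (\<integral>\<^sup>+w. ennreal (2 * half_sech v * (cut_monom (2*m - 2) w * conj_poisson (2 * half_gd v) w)) \<partial>lborel)"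
    using integrable_cut_monom_conj_poisson[OF c] conj_poisson_nonneg[OF c s]
    by (intro nn_integral_eq_integral[symmetric]) auto
  also have "\<dots> = (\<integral>\<^sup>+w. ennreal (tanh v) * ennreal (cut_monom (2*m - 2) w * (1 / (1 + cosh v * cosh w))) \<partial>lborel)"
  proof (intro nn_integral_cong)
    fix w
    have "2 * half_sech v * (cut_monom (2*m - 2) w * conj_poisson (2 * half_gd v) w)
       = cut_monom (2*m - 2) w * (2 * half_sech v * conj_poisson (2 * half_gd v) w)" by simp
    also have "\<dots> = tanh v * (cut_monom (2*m - 2) w * (1 / (1 + cosh v * cosh w)))"
      unfolding half_sech_conj_poisson by simp
    finally show "ennreal (2 * half_sech v * (cut_monom (2*m - 2) w * conj_poisson (2 * half_gd v) w))
       = ennreal (tanh v) * ennreal (cut_monom (2*m - 2) w * (1 / (1 + cosh v * cosh w)))"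
      using th by (simp only: ennreal_mult')
  qed
  also have "\<dots> = ennreal (tanh v) * (\<integral>\<^sup>+w. ennreal (cut_monom (2*m - 2) w * (1 / (1 + cosh v * cosh w))) \<partial>lborel)"
    unfolding cosh_def by (rule nn_integral_cmult) measurable
  also have "\<dots> = ennreal (tanh v) *
      (\<integral>\<^sup>+z. ennreal (cut_monom (Suc (2*m - 2)) z * (cosh v * sinh z / (1 + cosh v * cosh z)\<^sup>2)) \<partial>lborel)"
    by (subst nn_integral_cut_monom_by_parts) (auto simp: cosh_real_pos)
  also have "\<dots> = (\<integral>\<^sup>+z. ennreal (tanh v) *
      ennreal (cut_monom (Suc (2*m - 2)) z * (cosh v * sinh z / (1 + cosh v * cosh z)\<^sup>2)) \<partial>lborel)"
    unfolding cosh_def sinh_def by (rule nn_integral_cmult[symmetric]) measurable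
  also have "\<dots> = (\<integral>\<^sup>+z. ennreal (cut_monom (2*m - 1) z * sym_kernel v z) \<partial>lborel)"
  proof (intro nn_integral_cong)
    fix z
    have "tanh v * cosh v = sinh v" using cosh_real_pos[of v] by (simp add: tanh_def)
    then have "tanh v * (cut_monom (Suc (2*m - 2)) z * (cosh v * sinh z / (1 + cosh v * cosh z)\<^sup>2))
        = cut_monom (Suc (2*m - 2)) z * sym_kernel v z"
      by (simp add: sym_kernel_def flip: mult.assoc)
    moreover have "Suc (2*m - 2) = 2*m - 1" using assms by simp
    ultimately show "ennreal (tanh v) * ennreal (cut_monom (Suc (2*m - 2)) z * (cosh v * sinh z / (1 + cosh v * cosh z)\<^sup>2))
        = ennreal (cut_monom (2*m - 1) z * sym_kernel v z)"
      using th by (simp flip: ennreal_mult')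
  qed
  finally show "ennreal (2 * half_sech v * zpoly m (2 * half_gd v)) = (\<integral>\<^sup>+z. ennreal (cut_monom (2*m - 1) z * sym_kernel v z) \<partial>lborel)" .
qed

text \<open>Under the integral for \<open>W\<close> the weighted sum over \<open>i\<close> becomes
  \<open>zpoly m (2 * half_gd v)\<close>, which turns \<open>C m j\<close> into the double integral
  \<open>D m j\<close>; Tonelli and the symmetry of \<open>sym_kernel\<close> exchange
  \<open>m\<close> and \<open>j\<close>.\<close>

lemma zeta_W_symmetric:
  assumes "1 \<le> m" "1 \<le> j"
  shows "(\<Sum>i=1..m. 2 * zetabar (2*m - 2*i) * ((-1) ^ (i - 1) * W (2*j + 2*i - 1) (2*i)))
       = (\<Sum>i=1..j. 2 * zetabar (2*j - 2*i) * ((-1) ^ (i - 1) * W (2*m + 2*i - 1) (2*i)))"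
proof -
  define C where "C m j = (\<Sum>i=1..m. 2 * zetabar (2*m - 2*i) * ((-1) ^ (i - 1) * W (2*j + 2*i - 1) (2*i)))" for m j
  define D where "D m j = (\<integral>\<^sup>+v. \<integral>\<^sup>+z. ennreal (cut_monom (2*j - 1) v * (cut_monom (2*m - 1) z * sym_kernel v z)) \<partial>lborel \<partial>lborel)" for m j
  have C: "0 \<le> C m j \<and> ennreal (C m j) = D m j" if "1 \<le> m" "1 \<le> j" for m j
  proof -
    let ?f = "\<lambda>v. cut_monom (2*j - 1) v * (2 * half_sech v * zpoly m (2 * half_gd v))"
    have "has_bochner_integral lborel
       (\<lambda>v. \<Sum>i=1..m. 2 * zetabar (2*m - 2*i) * ((-1) ^ (i - 1) *
          (cut_monom (2*j - 1) v * (2 * half_sech v * ((2 * half_gd v) ^ (2*i - 1) / fact (2*i - 1))))))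
       (C m j)"
      unfolding C_def
      by (intro has_bochner_integral_sum has_bochner_integral_mult_right W_eq_integral) (use that in auto)
    then have f: "has_bochner_integral lborel ?f (C m j)"
      by (simp add: zpoly_def sum_distrib_left mult_ac)
    have f0: "0 \<le> ?f v" for v
      using zpoly_half_gd_nonneg[OF that(1), of v] by (cases "0 \<le> v") (auto simp: cut_monom_def)
    have "0 \<le> C m j"
      using f0 has_bochner_integral_integral_eq[OF f, symmetric] by (simp add: Bochner_Integration.integral_nonneg)
    have "ennreal (C m j) = (\<integral>\<^sup>+v. ennreal (?f v) \<partial>lborel)"
      using f f0 by (subst nn_integral_eq_integral) (auto simp: has_bochner_integral_iff)
    also have "\<dots> = D m j"
      unfolding D_def
    proof (intro nn_integral_cong)
      fix v
      show "ennreal (?f v) = (\<integral>\<^sup>+z. ennreal (cut_monom (2*j - 1) v * (cut_monom (2*m - 1) z * sym_kernel v z)) \<partial>lborel)"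
      proof (cases "0 \<le> v")
        case True
        have "ennreal (?f v) = ennreal (cut_monom (2*j - 1) v) * ennreal (2 * half_sech v * zpoly m (2 * half_gd v))"
          by (simp add: ennreal_mult')
        also have "\<dots> = (\<integral>\<^sup>+z. ennreal (cut_monom (2*j - 1) v) * ennreal (cut_monom (2*m - 1) z * sym_kernel v z) \<partial>lborel)"
          unfolding zpoly_half_gd_eq[OF that(1) True] by (rule nn_integral_cmult[symmetric]) measurable
        finally show ?thesis by (simp add: ennreal_mult')
      qed (simp add: cut_monom_def)
    qed
    finally show ?thesis using \<open>0 \<le> C m j\<close> by simp
  qed
  have "D m j = (\<integral>\<^sup>+z. \<integral>\<^sup>+v. ennreal (cut_monom (2*j - 1) v * (cut_monom (2*m - 1) z * sym_kernel v z)) \<partial>lborel \<partial>lborel)"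
    unfolding D_def by (rule lborel_pair.Fubini') measurable
  also have "\<dots> = D j m"
    unfolding D_def by (simp add: sym_kernel_def mult_ac)
  finally have "D m j = D j m" .
  \<comment> \<open>Nonnegativity of both sides is needed here, since \<open>ennreal\<close> is
    injective only on nonnegative reals.\<close>
  then have "C m j = C j m"
    using C[of m j] C[of j m] assms by (metis ennreal_inj)
  then show ?thesis by (simp add: C_def)
qed

section \<open>Transfer of the symmetry through the matrix Z\<close>

theorem theorem1p1:
  fixes m p :: nat
  assumes "0 < m" and "0 < p"
  shows "(-1) ^ m * (\<Sum>j=1..p. W (2*j + 2*m - 1) (2*m) * Zc j p)
       = (-1) ^ p * (\<Sum>j=1..m. W (2*j + 2*p - 1) (2*p) * Zc j m)"
proof -
  \<comment> \<open>The sign \<open>(-1) ^ i\<close> is part of the matrix; it differs from the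
    \<open>(-1) ^ (i - 1)\<close> of the symmetric sums by a global factor -1, which preserves the
    symmetry.\<close>
  define M where "M i j = (-1) ^ i * W (2*j + 2*i - 1) (2*i)" for i j
  have "(\<Sum>i=1..m. 2 * zetabar (2*m - 2*i) * M i j)
      = - (\<Sum>i=1..m. 2 * zetabar (2*m - 2*i) * ((-1) ^ (i - 1) * W (2*j + 2*i - 1) (2*i)))" for m j
    unfolding sum_negf[symmetric]
  proof (rule sum.cong[OF refl])
    fix i assume "i \<in> {1..m}"
    then have "(-1::real) ^ i = - ((-1) ^ (i - 1))" by (cases i) auto
    then show "2 * zetabar (2*m - 2*i) * M i j
        = - (2 * zetabar (2*m - 2*i) * ((-1) ^ (i - 1) * W (2*j + 2*i - 1) (2*i)))"
      by (simp add: M_def)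
  qed
  then have "(\<Sum>j=1..p. M m j * Zc j p) = (\<Sum>j=1..m. M p j * Zc j m)"
    using assms zeta_W_symmetric by (intro Zc_transform_symmetric) auto
  then show ?thesis
    by (simp add: M_def sum_distrib_left mult.assoc)
qed

end
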